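(* Let $A=Cl(\alpha,\beta_i,\gamma_i,\lambda_{ij})$ be a Clifford-type algebra over a field $k$ with $\operatorname{char} k\neq 2$. Then there exists a (classical) Clifford algebra $Cl(V,q)$ which is isomorphic to $A$. To find a presentation that makes this clear, one must find an orthogonal basis for the quadratic form $q:V\to k$ defined via the matrix $Q$.
   Context: Given scalars $\alpha,\beta_i,\gamma_i\in k$ ($1\le i\le n$) and $\lambda_{ij}\in k$ ($1\le i<j\le n$), the Clifford-type algebra $Cl(\alpha,\beta_i,\gamma_i,\lambda_{ij})$ is the unital associative $k$-algebra generated by elements $G,X_1,\ldots,X_n$ such that $G^2=\alpha$, $X_i^2=\beta_i$, $GX_i+X_iG=\gamma_i$ for all $i=1,\ldots,n$, and $X_iX_j+X_jX_i=\lambda_{ij}$ for all $i<j$. A $k$-basis is $\{G^jX_P\}$ with $j\in\{0,1\}$ and $X_P=X_{i_1}\cdots X_{i_s}$ for $P=\{i_1<\cdots<i_s\}\subseteq\{1,\ldots,n\}$. $V$ is the $k$-vector space with basis $(e_0,e_1,\ldots,e_n)$. $Q$ is the symmetric $(n+1)\times(n+1)$ matrix over $k$, with rows and columns indexed by $0,1,\ldots,n$, whose entries are $Q_{00}=\alpha$, $Q_{ii}=\beta_i$ for $1\le i\le n$, $Q_{0i}=Q_{i0}=\gamma_i/2$ for $1\le i\le n$, and $Q_{ij}=Q_{ji}=\lambda_{ij}/2$ for $1\le i<j\le n$. The quadratic form defined via $Q$ is $q:V\to k$, $q(v)=v^tQv$, where $v$ is identified with its coordinate vector in the basis $(e_0,\ldots,e_n)$.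 Orthogonality is with respect to the bilinear form $\beta_q(u,v)=q(u+v)-q(u)-q(v)$. For a quadratic form $q$ on a vector space $V$, the (classical) Clifford algebra $Cl(V,q)$ is the quotient of the tensor algebra $T(V)$ by the ideal generated by the elements $v\otimes v-q(v)1$, $v\in V$. *)

theory Defs
  imports
    "HOL-Library.Poly_Mapping"
    "HOL-Algebra.QuotRing"
    "Jordan_Normal_Form.VS_Connect"
begin

section \<open>Free algebras and presentations\<close>

text \<open>
  The free monoid on \<open>'x\<close>, written additively because multiplication of finitely supported
  functions \<open>'m \<Rightarrow>\<^sub>0 'k\<close> is convolution over an additive monoid \<open>'m\<close>.
\<close>

datatype 'x free_mon = Word "'x list"

primrec letters :: "'x free_mon \<Rightarrow> 'x set" where
  "letters (Word xs) = set xs"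

instantiation free_mon :: (type) monoid_add
begin

definition zero_free_mon :: "'a free_mon" where
  "0 = Word []"

fun plus_free_mon :: "'a free_mon \<Rightarrow> 'a free_mon \<Rightarrow> 'a free_mon" where
  "Word xs + Word ys = Word (xs @ ys)"

instance
proof
  fix a b c :: "'a free_mon"
  show "a + b + c = a + (b + c)" by (cases a; cases b; cases c) simp
  show "0 + a = a" by (cases a) (simp add: zero_free_mon_def)
  show "a + 0 = a" by (cases a) (simp add: zero_free_mon_def)
qed

end

text \<open>
  A \<open>k\<close>-algebra is given as a \<^typ>\<open>('k, 'a) module\<close> record: its ring structure together with
  the scalar multiplication.  The free algebra \<open>k\<langle>S\<rangle>\<close> consists of the noncommutative
  polynomials in letters from \<open>S\<close>.
\<close>

definition free_alg :: "'x set \<Rightarrow> ('k::field, 'x free_mon \<Rightarrow>\<^sub>0 'k) module" where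
  "free_alg S =
    \<lparr>carrier = {p. \<forall>w \<in> Poly_Mapping.keys p. letters w \<subseteq> S},
     mult = (*), one = 1, zero = 0, add = (+),
     smult = (\<lambda>c p. Poly_Mapping.single 0 c * p)\<rparr>"

definition free_gen :: "'x \<Rightarrow> 'x free_mon \<Rightarrow>\<^sub>0 'k::field" where
  "free_gen x = Poly_Mapping.single (Word [x]) 1"

definition free_const :: "'k \<Rightarrow> 'x free_mon \<Rightarrow>\<^sub>0 'k::field" where
  "free_const c = Poly_Mapping.single 0 c"

text \<open>
  \<^term>\<open>Idl\<^bsub>R\<^esub> S\<close> is defined as an intersection over all two-sided ideals of \<open>R\<close>, and the
  locale of ideals demands that \<open>R\<close> is a ring.
\<close>

lemma letters_plus: "letters (a + b) = letters a \<union> letters b"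
  by (cases a; cases b) simp

lemma ring_free_alg:
  "ring (free_alg S :: ('k::field, 'x free_mon \<Rightarrow>\<^sub>0 'k) module)" (is "ring ?A")
proof (rule ringI)
  show "abelian_group ?A"
  proof (rule abelian_groupI)
    fix p assume "p \<in> carrier ?A"
    then show "\<exists>y\<in>carrier ?A. y \<oplus>\<^bsub>?A\<^esub> p = \<zero>\<^bsub>?A\<^esub>"
      by (intro bexI[of _ "- p"]) (auto simp: free_alg_def keys_def)
  next
    fix p q assume "p \<in> carrier ?A" "q \<in> carrier ?A"
    then show "p \<oplus>\<^bsub>?A\<^esub> q \<in> carrier ?A"
      using Poly_Mapping.keys_add[of p q] by (auto simp: free_alg_def)
  qed (auto simp: free_alg_def algebra_simps)
  show "Group.monoid ?A"
  proof (rule monoidI)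
    fix p q assume "p \<in> carrier ?A" "q \<in> carrier ?A"
    then show "p \<otimes>\<^bsub>?A\<^esub> q \<in> carrier ?A"
      using keys_mult[of p q] by (fastforce simp: free_alg_def letters_plus)
  qed (auto simp: free_alg_def algebra_simps zero_free_mon_def)
qed (auto simp: free_alg_def algebra_simps)

text \<open>The quotient ring with the induced scalar multiplication \<open>c (I + x) = I + c x\<close>.\<close>

definition quot_alg :: "('k, 'a) module \<Rightarrow> 'a set \<Rightarrow> ('k, 'a set) module" where
  "quot_alg A I =
    ring.extend (A Quot I) (module.fields (\<lambda>c X. \<Union>x\<in>X. I +>\<^bsub>A\<^esub> (c \<odot>\<^bsub>A\<^esub> x)))"

text \<open>The algebra \<open>k\<langle>S | R\<rangle>\<close> with generators \<open>S\<close> and relations \<open>r = 0\<close> for \<open>r \<in> R\<close>.\<close>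

definition presented_alg ::
  "'x set \<Rightarrow> ('x free_mon \<Rightarrow>\<^sub>0 'k) set \<Rightarrow> ('k::field, ('x free_mon \<Rightarrow>\<^sub>0 'k) set) module" where
  "presented_alg S R = quot_alg (free_alg S) (Idl\<^bsub>free_alg S\<^esub> R)"

definition presented_gen ::
  "'x set \<Rightarrow> ('x free_mon \<Rightarrow>\<^sub>0 'k::field) set \<Rightarrow> 'x \<Rightarrow> ('x free_mon \<Rightarrow>\<^sub>0 'k) set" where
  "presented_gen S R x = (Idl\<^bsub>free_alg S\<^esub> R) +>\<^bsub>free_alg S\<^esub> free_gen x"

definition alg_iso :: "('k, 'a) module \<Rightarrow> ('k, 'b) module \<Rightarrow> ('a \<Rightarrow> 'b) set" where
  "alg_iso A B =
    {h \<in> ring_iso A B. \<forall>c. \<forall>x \<in> carrier A. h (c \<odot>\<^bsub>A\<^esub> x) = c \<odot>\<^bsub>B\<^esub> h x}"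


section \<open>Tensor algebra and classical Clifford algebra\<close>

text \<open>
  In the free algebra on the set of vectors, the words of length \<open>m\<close> span the free vector space
  on \<open>V\<^sup>m\<close>.  The two-sided ideal generated by the linearity relations is spanned by
  the multilinearity relations in each degree, so that the degree \<open>m\<close> part of the quotient is the
  \<open>m\<close>-th tensor power of \<open>V\<close>, with concatenation as multiplication.
\<close>

definition tensor_rels :: "('k::field, 'v) module \<Rightarrow> ('v free_mon \<Rightarrow>\<^sub>0 'k) set" where
  "tensor_rels V =
    {free_gen (u \<oplus>\<^bsub>V\<^esub> v) - free_gen u - free_gen v | u v. u \<in> carrier V \<and> v \<in> carrier V} \<union>
    {free_gen (c \<odot>\<^bsub>V\<^esub> v) - free_const c * free_gen v | c v. v \<in> carrier V}"

definition tensor_alg ::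
  "('k::field, 'v) module \<Rightarrow> ('k, ('v free_mon \<Rightarrow>\<^sub>0 'k) set) module" where
  "tensor_alg V = presented_alg (carrier V) (tensor_rels V)"

definition tensor_embed ::
  "('k::field, 'v) module \<Rightarrow> 'v \<Rightarrow> ('v free_mon \<Rightarrow>\<^sub>0 'k) set" where
  "tensor_embed V v = presented_gen (carrier V) (tensor_rels V) v"

definition clifford_alg ::
  "('k::field, 'v) module \<Rightarrow> ('v \<Rightarrow> 'k) \<Rightarrow> ('k, ('v free_mon \<Rightarrow>\<^sub>0 'k) set set) module" where
  "clifford_alg V q =
    (let T = tensor_alg V in
     quot_alg T (Idl\<^bsub>T\<^esub>
       {tensor_embed V v \<otimes>\<^bsub>T\<^esub> tensor_embed V v \<ominus>\<^bsub>T\<^esub> q v \<odot>\<^bsub>T\<^esub> \<one>\<^bsub>T\<^esub> | v. v \<in> carrier V}))"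

definition polar_form :: "('k::field, 'v) module \<Rightarrow> ('v \<Rightarrow> 'k) \<Rightarrow> 'v \<Rightarrow> 'v \<Rightarrow> 'k" where
  "polar_form V q u v = q (u \<oplus>\<^bsub>V\<^esub> v) - q u - q v"

definition orthogonal_basis ::
  "('k::field, 'v) module \<Rightarrow> ('v \<Rightarrow> 'k) \<Rightarrow> nat \<Rightarrow> (nat \<Rightarrow> 'v) \<Rightarrow> bool" where
  "orthogonal_basis V q n b \<longleftrightarrow>
    inj_on b {0..n} \<and> vectorspace.basis class_ring V (b ` {0..n}) \<and>
    (\<forall>i\<in>{0..n}. \<forall>j\<in>{0..n}. i \<noteq> j \<longrightarrow> polar_form V q (b i) (b j) = 0)"


section \<open>Clifford-type algebras\<close>

datatype cl_gen = Gen_G | Gen_X nat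

definition cl_gens :: "nat \<Rightarrow> cl_gen set" where
  "cl_gens n = insert Gen_G (Gen_X ` {1..n})"

definition cl_rels ::
  "nat \<Rightarrow> 'k \<Rightarrow> (nat \<Rightarrow> 'k) \<Rightarrow> (nat \<Rightarrow> 'k) \<Rightarrow> (nat \<Rightarrow> nat \<Rightarrow> 'k) \<Rightarrow> (cl_gen free_mon \<Rightarrow>\<^sub>0 'k::field) set"
  where
  "cl_rels n \<alpha> \<beta> \<gamma> lam =
    (let G = free_gen Gen_G; X = (\<lambda>i. free_gen (Gen_X i)) in
     {G * G - free_const \<alpha>} \<union>
     {X i * X i - free_const (\<beta> i) | i. i \<in> {1..n}} \<union>
     {G * X i + X i * G - free_const (\<gamma> i) | i. i \<in> {1..n}} \<union>
     {X i * X j + X j * X i - free_const (lam i j) | i j. i \<in> {1..n} \<and> j \<in> {1..n} \<and> i < j})"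

definition clifford_type_alg ::
  "nat \<Rightarrow> 'k \<Rightarrow> (nat \<Rightarrow> 'k) \<Rightarrow> (nat \<Rightarrow> 'k) \<Rightarrow> (nat \<Rightarrow> nat \<Rightarrow> 'k) \<Rightarrow>
    ('k::field, (cl_gen free_mon \<Rightarrow>\<^sub>0 'k) set) module" where
  "clifford_type_alg n \<alpha> \<beta> \<gamma> lam = presented_alg (cl_gens n) (cl_rels n \<alpha> \<beta> \<gamma> lam)"

definition clifford_type_gen ::
  "nat \<Rightarrow> 'k \<Rightarrow> (nat \<Rightarrow> 'k) \<Rightarrow> (nat \<Rightarrow> 'k) \<Rightarrow> (nat \<Rightarrow> nat \<Rightarrow> 'k) \<Rightarrow>
    cl_gen \<Rightarrow> (cl_gen free_mon \<Rightarrow>\<^sub>0 'k::field) set" where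
  "clifford_type_gen n \<alpha> \<beta> \<gamma> lam = presented_gen (cl_gens n) (cl_rels n \<alpha> \<beta> \<gamma> lam)"

text \<open>The linear map from \<open>k\<^sup>n\<^sup>+\<^sup>1\<close> to the algebra with \<open>e\<^sub>0 \<mapsto> G\<close> and \<open>e\<^sub>i \<mapsto> X\<^sub>i\<close>.\<close>

definition clifford_type_lin ::
  "nat \<Rightarrow> 'k \<Rightarrow> (nat \<Rightarrow> 'k) \<Rightarrow> (nat \<Rightarrow> 'k) \<Rightarrow> (nat \<Rightarrow> nat \<Rightarrow> 'k) \<Rightarrow>
    'k vec \<Rightarrow> (cl_gen free_mon \<Rightarrow>\<^sub>0 'k::field) set" where
  "clifford_type_lin n \<alpha> \<beta> \<gamma> lam v =
    (let A = clifford_type_alg n \<alpha> \<beta> \<gamma> lam; g = clifford_type_gen n \<alpha> \<beta> \<gamma> lam in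
     (v $ 0) \<odot>\<^bsub>A\<^esub> g Gen_G \<oplus>\<^bsub>A\<^esub> (\<Oplus>\<^bsub>A\<^esub>i\<in>{1..n}. (v $ i) \<odot>\<^bsub>A\<^esub> g (Gen_X i)))"

definition cl_matrix ::
  "nat \<Rightarrow> 'k::field \<Rightarrow> (nat \<Rightarrow> 'k) \<Rightarrow> (nat \<Rightarrow> 'k) \<Rightarrow> (nat \<Rightarrow> nat \<Rightarrow> 'k) \<Rightarrow> 'k mat" where
  "cl_matrix n \<alpha> \<beta> \<gamma> lam = mat (n + 1) (n + 1) (\<lambda>(i, j).
     if i = 0 \<and> j = 0 then \<alpha>
     else if i = j then \<beta> i
     else if i = 0 then \<gamma> j / 2
     else if j = 0 then \<gamma> i / 2
     else if i < j then lam i j / 2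
     else lam j i / 2)"

definition cl_form ::
  "nat \<Rightarrow> 'k::field \<Rightarrow> (nat \<Rightarrow> 'k) \<Rightarrow> (nat \<Rightarrow> 'k) \<Rightarrow> (nat \<Rightarrow> nat \<Rightarrow> 'k) \<Rightarrow> 'k vec \<Rightarrow> 'k" where
  "cl_form n \<alpha> \<beta> \<gamma> lam v = v \<bullet> (cl_matrix n \<alpha> \<beta> \<gamma> lam *\<^sub>v v)"

text \<open>
  The images in the algebra of the vectors \<open>b\<^sub>0, \<dots>, b\<^sub>n\<close> are the generators of a presentation with
  relations \<open>Y\<^sub>i\<^sup>2 = d\<^sub>i\<close> and \<open>Y\<^sub>i Y\<^sub>j + Y\<^sub>j Y\<^sub>i = 0\<close> for \<open>i \<noteq> j\<close>, that is, of a Clifford-type algebra whose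
  parameters \<open>\<gamma>\<^sub>i\<close> and \<open>\<lambda>\<^sub>i\<^sub>j\<close> vanish.
\<close>

definition diagonal_presentation ::
  "nat \<Rightarrow> 'k::field \<Rightarrow> (nat \<Rightarrow> 'k) \<Rightarrow> (nat \<Rightarrow> 'k) \<Rightarrow> (nat \<Rightarrow> nat \<Rightarrow> 'k) \<Rightarrow>
    (nat \<Rightarrow> 'k vec) \<Rightarrow> (nat \<Rightarrow> 'k) \<Rightarrow> bool" where
  "diagonal_presentation n \<alpha> \<beta> \<gamma> lam b d \<longleftrightarrow>
    (let D = clifford_type_alg n (d 0) d (\<lambda>_. 0) (\<lambda>_ _. 0);
         g = clifford_type_gen n (d 0) d (\<lambda>_. 0) (\<lambda>_ _. 0)
     in \<exists>\<phi> \<in> alg_iso D (clifford_type_alg n \<alpha> \<beta> \<gamma> lam).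
          \<phi> (g Gen_G) = clifford_type_lin n \<alpha> \<beta> \<gamma> lam (b 0) \<and>
          (\<forall>i\<in>{1..n}. \<phi> (g (Gen_X i)) = clifford_type_lin n \<alpha> \<beta> \<gamma> lam (b i)))"

end

theory Submission
  imports Defs "Jordan_Normal_Form.DL_Rank"
begin

text \<open>
  Write \<open>V = k\<^sup>n\<^sup>+\<^sup>1\<close> and let \<open>q\<close> be the quadratic form of the matrix \<open>Q\<close>.  Call a linear map \<open>\<phi>\<close> from
  \<open>V\<close> to a \<open>k\<close>-algebra a Clifford map if \<open>\<phi>(v)\<^sup>2 = q(v) 1\<close> for all \<open>v\<close>.  Polarization turns this
  condition into \<open>y\<^sub>i y\<^sub>j + y\<^sub>j y\<^sub>i = 2 Q\<^sub>i\<^sub>j 1\<close> for the images \<open>y\<^sub>0, \<dots>, y\<^sub>n\<close> of the unit vectors, and since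
  \<open>2\<close> is invertible nothing is lost: families with these relations and Clifford maps are the same
  thing.  For \<open>y\<^sub>0 = G\<close> and \<open>y\<^sub>i = X\<^sub>i\<close> the relations are exactly the defining relations of the
  Clifford-type algebra \<open>A\<close>.  So the linear map \<open>V \<rightarrow> A\<close> with \<open>e\<^sub>0 \<mapsto> G\<close>, \<open>e\<^sub>i \<mapsto> X\<^sub>i\<close> is a universal
  Clifford map (\<open>clifford_type_universal\<close>).  The canonical map \<open>V \<rightarrow> Cl(V,q)\<close> is one as well
  (\<open>clifford_alg_universal\<close>), and two universal objects are isomorphic (\<open>clifford_alg_iso\<close>).

  The same argument shows that an invertible matrix \<open>P\<close> which carries one form to another induces an
  isomorphism of Clifford-type algebras (\<open>change_of_basis\<close>).  If the columns of \<open>P\<close> are an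
  orthogonal basis \<open>b\<close>, then \<open>P\<^sup>T Q P\<close> is diagonal with entries \<open>q(b\<^sub>i)\<close>, and this isomorphism is the
  diagonal presentation.  An orthogonal basis exists by symmetric elimination, again because \<open>2\<close> is
  invertible (\<open>exists_orthogonal_family\<close>).

  For the converse one must know that the algebra is not too small.  The diagonal algebra \<open>D\<close> acts on
  functions on sets of naturals by signed, weighted toggling of elements, in the way in which
  Clifford multiplication acts on the exterior algebra (\<open>representation\<close>).  This shows that the
  generators of \<open>D\<close> are linearly independent and that \<open>1 \<noteq> 0\<close>; the latter passes to \<open>A\<close>.  If now
  the images in \<open>A\<close> of vectors \<open>b\<^sub>0, \<dots>, b\<^sub>n\<close> correspond to the generators of \<open>D\<close>, then these
  \<open>n + 1\<close> vectors are linearly independent, hence a basis.  The anticommutation of distinct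
  generators says that the polar form of \<open>b\<^sub>i\<close> and \<open>b\<^sub>j\<close>, times \<open>1\<close>, vanishes, so that they are
  orthogonal.
\<close>

section \<open>Algebras over a field\<close>

lemma update_eq_add_single:
  "w \<notin> Poly_Mapping.keys f \<Longrightarrow> Poly_Mapping.update w c f = f + Poly_Mapping.single w c"
  by (intro poly_mapping_eqI) (auto simp: lookup_update lookup_add lookup_single in_keys_iff)

text \<open>
  The scalars form a whole type, but the algebra lives on a carrier, and its multiplication need
  not be commutative.
\<close>

locale k_algebra = ring A for A :: "('k::field, 'a) module" (structure) +
  assumes smult_closed [simp, intro]: "x \<in> carrier A \<Longrightarrow> c \<odot> x \<in> carrier A"
    and smult_l_distr: "x \<in> carrier A \<Longrightarrow> (c + d) \<odot> x = c \<odot> x \<oplus> d \<odot> x"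
    and smult_r_distr: "x \<in> carrier A \<Longrightarrow> y \<in> carrier A \<Longrightarrow> c \<odot> (x \<oplus> y) = c \<odot> x \<oplus> c \<odot> y"
    and smult_assoc: "x \<in> carrier A \<Longrightarrow> (c * d) \<odot> x = c \<odot> (d \<odot> x)"
    and smult_one [simp]: "x \<in> carrier A \<Longrightarrow> 1 \<odot> x = x"
    and smult_mult_l: "x \<in> carrier A \<Longrightarrow> y \<in> carrier A \<Longrightarrow> (c \<odot> x) \<otimes> y = c \<odot> (x \<otimes> y)"
    and smult_mult_r: "x \<in> carrier A \<Longrightarrow> y \<in> carrier A \<Longrightarrow> x \<otimes> (c \<odot> y) = c \<odot> (x \<otimes> y)"
begin

lemma zero_smult [simp]:
  assumes "x \<in> carrier A"
  shows "0 \<odot> x = \<zero>"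
proof -
  have "0 \<odot> x \<oplus> 0 \<odot> x = 0 \<odot> x"
    using smult_l_distr[OF assms, of 0 0] by simp
  then show ?thesis using assms by (metis add.l_cancel_one' smult_closed)
qed

lemma smult_zero [simp]: "c \<odot> \<zero> = \<zero>"
  using smult_assoc[of "\<zero>" c 0] by simp

lemma smult_uminus: "x \<in> carrier A \<Longrightarrow> (- c) \<odot> x = \<ominus> (c \<odot> x)"
  using smult_l_distr[of x "- c" c] by (metis minus_equality add.left_inverse smult_closed zero_smult)

lemma finsum_smult:
  "finite F \<Longrightarrow> f \<in> F \<rightarrow> carrier A \<Longrightarrow> c \<odot> (\<Oplus>i\<in>F. f i) = (\<Oplus>i\<in>F. c \<odot> f i)"
  by (induction F rule: finite_induct) (simp_all add: Pi_def smult_r_distr)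

primrec word_eval :: "('x \<Rightarrow> 'a) \<Rightarrow> 'x free_mon \<Rightarrow> 'a" where
  "word_eval g (Word xs) = foldr (\<lambda>x a. g x \<otimes> a) xs \<one>"

definition free_eval :: "('x \<Rightarrow> 'a) \<Rightarrow> ('x free_mon \<Rightarrow>\<^sub>0 'k) \<Rightarrow> 'a" where
  "free_eval g p = (\<Oplus>w\<in>Poly_Mapping.keys p. Poly_Mapping.lookup p w \<odot> word_eval g w)"

context
  fixes g :: "'x \<Rightarrow> 'a"
  assumes g: "\<And>x. g x \<in> carrier A"
begin

lemma word_eval_closed [simp]: "word_eval g w \<in> carrier A"
proof (cases w)
  case (Word xs)
  have "foldr (\<lambda>x a. g x \<otimes> a) xs \<one> \<in> carrier A" by (induction xs) (simp_all add: g)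
  with Word show ?thesis by simp
qed

lemma word_eval_plus: "word_eval g (u + v) = word_eval g u \<otimes> word_eval g v"
proof (cases u; cases v)
  fix xs ys assume uv: "u = Word xs" "v = Word ys"
  have "word_eval g (Word (xs @ ys)) = word_eval g (Word xs) \<otimes> word_eval g (Word ys)"
    using word_eval_closed[of "Word _"]
    by (induction xs) (simp_all add: g m_assoc)
  with uv show ?thesis by simp
qed

lemma free_eval_superset:
  assumes "finite F" "Poly_Mapping.keys p \<subseteq> F"
  shows "free_eval g p = (\<Oplus>w\<in>F. Poly_Mapping.lookup p w \<odot> word_eval g w)"
  unfolding free_eval_def
  by (rule add.finprod_mono_neutral_cong_left)
     (use assms in \<open>auto simp: in_keys_iff\<close>)

lemma free_eval_closed [simp]: "free_eval g p \<in> carrier A"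
  unfolding free_eval_def by (rule finsum_closed) auto

lemma free_eval_add: "free_eval g (p + q) = free_eval g p \<oplus> free_eval g q"
proof -
  let ?F = "Poly_Mapping.keys p \<union> Poly_Mapping.keys q"
  have "free_eval g (p + q) = (\<Oplus>w\<in>?F. Poly_Mapping.lookup (p + q) w \<odot> word_eval g w)"
    by (rule free_eval_superset) (auto dest: Poly_Mapping.keys_add[THEN subsetD])
  also have "\<dots> = (\<Oplus>w\<in>?F. Poly_Mapping.lookup p w \<odot> word_eval g w \<oplus> Poly_Mapping.lookup q w \<odot> word_eval g w)"
    by (rule finsum_cong') (auto simp: lookup_add smult_l_distr)
  also have "\<dots> = free_eval g p \<oplus> free_eval g q"
    by (simp add: finsum_addf free_eval_superset[of ?F])
  finally show ?thesis .
qed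

lemma free_eval_single: "free_eval g (Poly_Mapping.single w c) = c \<odot> word_eval g w"
  using free_eval_superset[of "{w}" "Poly_Mapping.single w c"] by simp

text \<open>
  By bilinearity it suffices to compare both sides on single words, where multiplicativity is
  concatenation of words.
\<close>

lemma free_eval_mult: "free_eval g (p * q) = free_eval g p \<otimes> free_eval g q"
proof -
  have zero: "free_eval g 0 = \<zero>"
    by (simp add: free_eval_def)
  have single: "free_eval g (Poly_Mapping.single u c * q) = free_eval g (Poly_Mapping.single u c) \<otimes> free_eval g q" for u c
    by (induction q rule: update_induct)
       (simp_all add: update_eq_add_single zero distrib_left free_eval_add r_distr mult_single free_eval_single
          word_eval_plus smult_mult_l smult_mult_r smult_assoc[symmetric] mult.commute)
  show ?thesis
    by (induction p rule: update_induct)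
       (simp_all add: update_eq_add_single zero distrib_right free_eval_add l_distr single)
qed

end

end

section \<open>Algebra homomorphisms\<close>

definition alg_hom :: "('k, 'a) module \<Rightarrow> ('k, 'b) module \<Rightarrow> ('a \<Rightarrow> 'b) set" where
  "alg_hom A B = {h \<in> Ring.ring_hom A B. \<forall>c. \<forall>x \<in> carrier A. h (c \<odot>\<^bsub>A\<^esub> x) = c \<odot>\<^bsub>B\<^esub> h x}"

lemma alg_hom_closed: "h \<in> alg_hom A B \<Longrightarrow> x \<in> carrier A \<Longrightarrow> h x \<in> carrier B"
  and alg_hom_mult: "h \<in> alg_hom A B \<Longrightarrow> x \<in> carrier A \<Longrightarrow> y \<in> carrier A \<Longrightarrow> h (x \<otimes>\<^bsub>A\<^esub> y) = h x \<otimes>\<^bsub>B\<^esub> h y"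
  and alg_hom_add: "h \<in> alg_hom A B \<Longrightarrow> x \<in> carrier A \<Longrightarrow> y \<in> carrier A \<Longrightarrow> h (x \<oplus>\<^bsub>A\<^esub> y) = h x \<oplus>\<^bsub>B\<^esub> h y"
  and alg_hom_one: "h \<in> alg_hom A B \<Longrightarrow> h \<one>\<^bsub>A\<^esub> = \<one>\<^bsub>B\<^esub>"
  and alg_hom_smult: "h \<in> alg_hom A B \<Longrightarrow> x \<in> carrier A \<Longrightarrow> h (c \<odot>\<^bsub>A\<^esub> x) = c \<odot>\<^bsub>B\<^esub> h x"
  by (auto simp: alg_hom_def Ring.ring_hom_def)

lemma alg_homI:
  assumes "\<And>x. x \<in> carrier A \<Longrightarrow> h x \<in> carrier B"
    and "\<And>x y. x \<in> carrier A \<Longrightarrow> y \<in> carrier A \<Longrightarrow> h (x \<otimes>\<^bsub>A\<^esub> y) = h x \<otimes>\<^bsub>B\<^esub> h y"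
    and "\<And>x y. x \<in> carrier A \<Longrightarrow> y \<in> carrier A \<Longrightarrow> h (x \<oplus>\<^bsub>A\<^esub> y) = h x \<oplus>\<^bsub>B\<^esub> h y"
    and "h \<one>\<^bsub>A\<^esub> = \<one>\<^bsub>B\<^esub>"
    and "\<And>c x. x \<in> carrier A \<Longrightarrow> h (c \<odot>\<^bsub>A\<^esub> x) = c \<odot>\<^bsub>B\<^esub> h x"
  shows "h \<in> alg_hom A B"
  using assms by (auto simp: alg_hom_def Ring.ring_hom_def)

lemma alg_hom_comp: "f \<in> alg_hom A B \<Longrightarrow> g \<in> alg_hom B C \<Longrightarrow> g \<circ> f \<in> alg_hom A C"
  by (rule alg_homI)
     (simp_all add: alg_hom_closed alg_hom_mult alg_hom_add alg_hom_one alg_hom_smult)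

lemma alg_hom_zero:
  assumes "k_algebra A" "k_algebra B" "h \<in> alg_hom A B"
  shows "h \<zero>\<^bsub>A\<^esub> = \<zero>\<^bsub>B\<^esub>"
proof -
  interpret A: k_algebra A by fact
  interpret B: k_algebra B by fact
  have "h (0 \<odot>\<^bsub>A\<^esub> \<zero>\<^bsub>A\<^esub>) = 0 \<odot>\<^bsub>B\<^esub> h \<zero>\<^bsub>A\<^esub>" using assms(3) by (intro alg_hom_smult) auto
  then show ?thesis using alg_hom_closed[OF assms(3)] by simp
qed

lemma alg_hom_minus:
  assumes "k_algebra A" "k_algebra B" "h \<in> alg_hom A B" "x \<in> carrier A" "y \<in> carrier A"
  shows "h (x \<ominus>\<^bsub>A\<^esub> y) = h x \<ominus>\<^bsub>B\<^esub> h y"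
proof -
  interpret A: k_algebra A by fact
  interpret B: k_algebra B by fact
  have "\<ominus>\<^bsub>A\<^esub> y = (- 1) \<odot>\<^bsub>A\<^esub> y" "\<ominus>\<^bsub>B\<^esub> h y = (- 1) \<odot>\<^bsub>B\<^esub> h y"
    using A.smult_uminus[of y 1] B.smult_uminus[of "h y" 1] assms alg_hom_closed[OF assms(3)] by auto
  then show ?thesis
    unfolding a_minus_def using assms by (simp add: alg_hom_add[OF assms(3)] alg_hom_smult[OF assms(3)])
qed

lemma alg_hom_finsum:
  assumes "k_algebra A" "k_algebra B" "h \<in> alg_hom A B" "finite F" "\<And>i. i \<in> F \<Longrightarrow> f i \<in> carrier A"
  shows "h (\<Oplus>\<^bsub>A\<^esub>i\<in>F. f i) = (\<Oplus>\<^bsub>B\<^esub>i\<in>F. h (f i))"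
proof -
  interpret A: k_algebra A by fact
  interpret B: k_algebra B by fact
  from assms(4,5) show ?thesis
  proof (induction F rule: finite_induct)
    case empty
    show ?case using alg_hom_zero[OF assms(1-3)] by simp
  next
    case (insert i F)
    then have "f \<in> F \<rightarrow> carrier A" "(\<lambda>i. h (f i)) \<in> F \<rightarrow> carrier B"
      using alg_hom_closed[OF assms(3)] by auto
    with insert show ?case
      using alg_hom_closed[OF assms(3)] by (simp add: alg_hom_add[OF assms(3)])
  qed
qed

text \<open>
  An isomorphism is always obtained below from two homomorphisms given by universal properties.
\<close>

lemma alg_isoI:
  assumes f: "f \<in> alg_hom A B" and g: "g \<in> alg_hom B A"
    and gf: "\<And>x. x \<in> carrier A \<Longrightarrow> g (f x) = x" and fg: "\<And>y. y \<in> carrier B \<Longrightarrow> f (g y) = y"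
  shows "f \<in> alg_iso A B"
proof -
  have "bij_betw f (carrier A) (carrier B)"
    by (rule bij_betwI[of _ _ _ g]) (use assms alg_hom_closed in auto)
  with f show ?thesis by (auto simp: alg_iso_def alg_hom_def ring_iso_def)
qed

lemma alg_iso_hom: "f \<in> alg_iso A B \<Longrightarrow> f \<in> alg_hom A B"
  and alg_iso_inj: "f \<in> alg_iso A B \<Longrightarrow> inj_on f (carrier A)"
  by (auto simp: alg_iso_def alg_hom_def ring_iso_def bij_betw_def)

section \<open>Free algebras\<close>

lemma free_gen_carrier [simp]: "x \<in> S \<Longrightarrow> free_gen x \<in> carrier (free_alg S)"
  and free_const_carrier [simp]: "free_const c \<in> carrier (free_alg S)"
  by (auto simp: free_alg_def free_gen_def free_const_def zero_free_mon_def)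

lemma free_alg_carrier_closed [simp]:
  assumes "p \<in> carrier (free_alg S)" "q \<in> carrier (free_alg S)"
  shows "p + q \<in> carrier (free_alg S)" "p * q \<in> carrier (free_alg S)" "p - q \<in> carrier (free_alg S)"
proof -
  interpret ring "free_alg S" by (rule ring_free_alg)
  show "p + q \<in> carrier (free_alg S)" using a_closed[OF assms] by (simp add: free_alg_def)
  show "p * q \<in> carrier (free_alg S)" using m_closed[OF assms] by (simp add: free_alg_def)
  have "- q \<in> carrier (free_alg S)" using assms(2) by (auto simp: free_alg_def keys_def)
  from a_closed[OF assms(1) this] show "p - q \<in> carrier (free_alg S)" by (simp add: free_alg_def)
qed

lemma free_const_add: "free_const (c + d) = free_const c + free_const d"
  and free_const_mult: "free_const (c * d) = free_const c * free_const d"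
  and free_const_1: "free_const 1 = 1"
  by (simp_all add: free_const_def single_add mult_single)

text \<open>
  A constant sits on the empty word, so it commutes with every word; this makes the free algebra an
  algebra over the constants.
\<close>

lemma free_const_central: "p * free_const c = free_const c * p"
  by (induction p rule: update_induct)
     (simp_all add: update_eq_add_single distrib_left distrib_right mult_single free_const_def mult.commute)

lemma k_algebra_free_alg: "k_algebra (free_alg S :: ('k::field, 'x free_mon \<Rightarrow>\<^sub>0 'k) module)"
proof -
  let ?A = "free_alg S :: ('k, 'x free_mon \<Rightarrow>\<^sub>0 'k) module"
  interpret ring ?A by (rule ring_free_alg)
  have sm: "c \<odot>\<^bsub>?A\<^esub> p = free_const c * p" for c p by (simp add: free_alg_def free_const_def)
  have ops: "p \<oplus>\<^bsub>?A\<^esub> q = p + q" "p \<otimes>\<^bsub>?A\<^esub> q = p * q" for p q by (simp_all add: free_alg_def)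
  show ?thesis
    by unfold_locales
       (simp_all add: sm ops free_const_add free_const_mult free_const_1 distrib_left distrib_right
         mult.assoc, metis free_const_central mult.assoc)
qed

text \<open>
  The relations are written with the operations of the type of finitely supported functions.  These
  rules evaluate a homomorphism on them.
\<close>

lemma alg_hom_free_ops:
  fixes B :: "('k::field, 'b) module"
  assumes "k_algebra B" "h \<in> alg_hom (free_alg S) B"
  shows "p \<in> carrier (free_alg S) \<Longrightarrow> q \<in> carrier (free_alg S) \<Longrightarrow> h (p + q) = h p \<oplus>\<^bsub>B\<^esub> h q"
    and "p \<in> carrier (free_alg S) \<Longrightarrow> q \<in> carrier (free_alg S) \<Longrightarrow> h (p * q) = h p \<otimes>\<^bsub>B\<^esub> h q"
    and "p \<in> carrier (free_alg S) \<Longrightarrow> q \<in> carrier (free_alg S) \<Longrightarrow> h (p - q) = h p \<ominus>\<^bsub>B\<^esub> h q"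
    and "h (free_const c) = c \<odot>\<^bsub>B\<^esub> \<one>\<^bsub>B\<^esub>"
proof -
  let ?A = "free_alg S :: ('k, 'a free_mon \<Rightarrow>\<^sub>0 'k) module"
  interpret A: k_algebra ?A by (rule k_algebra_free_alg)
  have ops: "p \<oplus>\<^bsub>?A\<^esub> q = p + q" "p \<otimes>\<^bsub>?A\<^esub> q = p * q" for p q by (simp_all add: free_alg_def)
  {
    assume p: "p \<in> carrier ?A" and q: "q \<in> carrier ?A"
    show "h (p + q) = h p \<oplus>\<^bsub>B\<^esub> h q" using alg_hom_add[OF assms(2) p q] by (simp add: ops)
    show "h (p * q) = h p \<otimes>\<^bsub>B\<^esub> h q" using alg_hom_mult[OF assms(2) p q] by (simp add: ops)
    have "p \<ominus>\<^bsub>?A\<^esub> q = p - q"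
    proof -
      have "(p - q) \<oplus>\<^bsub>?A\<^esub> q = p" by (simp add: ops)
      then show ?thesis using p q
        by (metis A.add.inv_solve_right A.minus_eq free_alg_carrier_closed(3))
    qed
    then show "h (p - q) = h p \<ominus>\<^bsub>B\<^esub> h q"
      using alg_hom_minus[OF k_algebra_free_alg assms p q] by simp
  }
  have "free_const c = c \<odot>\<^bsub>?A\<^esub> \<one>\<^bsub>?A\<^esub>" by (simp add: free_alg_def free_const_def)
  then show "h (free_const c) = c \<odot>\<^bsub>B\<^esub> \<one>\<^bsub>B\<^esub>"
    using alg_hom_smult[OF assms(2), of "\<one>\<^bsub>?A\<^esub>" c] alg_hom_one[OF assms(2)] by simp
qed

lemma free_alg_universal:
  fixes B :: "('k::field, 'b) module"
  assumes "k_algebra B" and g: "\<And>x. x \<in> S \<Longrightarrow> g x \<in> carrier B"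
  shows "\<exists>h\<in>alg_hom (free_alg S) B. \<forall>x\<in>S. h (free_gen x) = g x"
proof -
  interpret B: k_algebra B by fact
  \<comment> \<open>The evaluation is multiplicative on all words, so \<open>g\<close> is extended to all letters.\<close>
  define g' where "g' x = (if x \<in> S then g x else \<zero>\<^bsub>B\<^esub>)" for x
  have g': "g' x \<in> carrier B" for x using g by (simp add: g'_def)
  let ?h = "B.free_eval g'"
  have one: "?h (Poly_Mapping.single 0 c) = c \<odot>\<^bsub>B\<^esub> \<one>\<^bsub>B\<^esub>" for c
    by (simp add: B.free_eval_single[OF g'] zero_free_mon_def)
  have "?h \<in> alg_hom (free_alg S) B"
    by (rule alg_homI)
       (use one[of 1] in \<open>simp_all add: free_alg_def B.free_eval_closed[OF g'] B.free_eval_mult[OF g']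
         B.free_eval_add[OF g'] one B.smult_mult_l\<close>)
  moreover have "?h (free_gen x) = g x" if "x \<in> S" for x
    using that g by (simp add: free_gen_def B.free_eval_single[OF g'] g'_def)
  ultimately show ?thesis by blast
qed

text \<open>
  Every element is a sum of scalar multiples of words, and words are products of generators.
\<close>

lemma free_alg_hom_eqI:
  fixes B :: "('k::field, 'b) module"
  assumes "k_algebra B" and f: "f \<in> alg_hom (free_alg S) B" and g: "g \<in> alg_hom (free_alg S) B"
    and gen: "\<And>x. x \<in> S \<Longrightarrow> f (free_gen x) = g (free_gen x)"
    and "p \<in> carrier (free_alg S)"
  shows "f p = g p"
  using \<open>p \<in> carrier (free_alg S)\<close>
proof (induction p rule: update_induct)
  case const
  show ?case
    using alg_hom_zero[OF k_algebra_free_alg assms(1) f] alg_hom_zero[OF k_algebra_free_alg assms(1) g]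
    by (simp add: free_alg_def)
next
  case (update p w c)
  obtain xs where w: "w = Word xs" by (cases w)
  have word: "Poly_Mapping.single (Word xs) (1::'k) \<in> carrier (free_alg S) \<and>
    f (Poly_Mapping.single (Word xs) 1) = g (Poly_Mapping.single (Word xs) 1)" if "set xs \<subseteq> S" for xs
    using that
  proof (induction xs)
    case Nil
    have "Poly_Mapping.single (Word []) 1 = (free_const 1 :: 'a free_mon \<Rightarrow>\<^sub>0 'k)"
      by (simp add: free_const_def zero_free_mon_def)
    then show ?case
      by (simp add: alg_hom_free_ops[OF assms(1) f] alg_hom_free_ops[OF assms(1) g])
  next
    case (Cons x xs)
    have "Poly_Mapping.single (Word (x # xs)) (1::'k) = free_gen x * Poly_Mapping.single (Word xs) 1"
      by (simp add: free_gen_def mult_single)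
    with Cons gen show ?case
      by (simp add: alg_hom_free_ops[OF assms(1) f] alg_hom_free_ops[OF assms(1) g])
  qed
  have upd: "Poly_Mapping.update w c p = p + free_const c * Poly_Mapping.single w 1"
    using update by (simp add: update_eq_add_single free_const_def mult_single)
  have keys: "Poly_Mapping.keys (Poly_Mapping.update w c p) = insert w (Poly_Mapping.keys p)"
    using update.hyps by (auto simp: in_keys_iff lookup_update split: if_splits)
  have "\<forall>u\<in>insert w (Poly_Mapping.keys p). letters u \<subseteq> S"
    using update.prems by (simp add: free_alg_def keys)
  then have p: "p \<in> carrier (free_alg S)" and "set xs \<subseteq> S"
    using w by (simp_all add: free_alg_def)
  with word[of xs] update.IH show ?case
    unfolding upd by (simp add: w alg_hom_free_ops[OF assms(1) f] alg_hom_free_ops[OF assms(1) g])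
qed

section \<open>Quotient algebras\<close>

lemma ring_extend:
  fixes R :: "'a ring"
  assumes "ring R"
  shows "ring (ring.extend R m)"
proof -
  interpret ring R by fact
  show ?thesis
  proof (rule ringI)
    show "abelian_group (ring.extend R m)"
    proof (rule abelian_groupI)
      fix x assume "x \<in> carrier (ring.extend R m)"
      then show "\<exists>y\<in>carrier (ring.extend R m). y \<oplus>\<^bsub>ring.extend R m\<^esub> x = \<zero>\<^bsub>ring.extend R m\<^esub>"
        by (intro bexI[of _ "\<ominus>\<^bsub>R\<^esub> x"]) (simp_all add: ring.defs l_neg)
    qed (simp_all add: ring.defs a_ac)
    show "Group.monoid (ring.extend R m)" by (rule monoidI) (simp_all add: ring.defs m_assoc)
  qed (simp_all add: ring.defs l_distr r_distr)
qed

context k_algebra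
begin

context
  fixes I
  assumes I: "ideal I A"
begin

interpretation ideal I A by (rule I)

text \<open>
  An ideal is closed under scalars, because \<open>c i = (c 1) i\<close>.  Hence all the cosets in the union that
  defines the scalar multiplication coincide.
\<close>

lemma quot_alg_smult:
  assumes "a \<in> carrier A"
  shows "c \<odot>\<^bsub>quot_alg A I\<^esub> (I +> a) = I +> (c \<odot> a)"
proof -
  have "I +> (c \<odot> x) = I +> (c \<odot> a)" if "x \<in> I +> a" for x
  proof -
    from that obtain i where i: "i \<in> I" "x = i \<oplus> a" by (auto simp: a_r_coset_def')
    then have "i \<in> carrier A" using a_subset by auto
    moreover have "c \<odot> i = (c \<odot> \<one>) \<otimes> i" using \<open>i \<in> carrier A\<close> by (simp add: smult_mult_l)
    then have "c \<odot> i \<in> I" using i(1) I_l_closed by simp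
    ultimately have "c \<odot> x \<in> I +> (c \<odot> a)"
      using i assms by (auto simp: a_r_coset_def' smult_r_distr)
    then show ?thesis using a_repr_independence' assms by (metis smult_closed)
  qed
  moreover have "I +> a \<noteq> {}" using a_rcos_self assms by blast
  ultimately have "(\<Union>x\<in>I +> a. I +> (c \<odot> x)) = I +> (c \<odot> a)" by (rule SUP_eq_const[rotated])
  then show ?thesis by (simp add: quot_alg_def ring.defs module.defs)
qed

lemma carrier_quot_alg: "carrier (quot_alg A I) = (\<lambda>a. I +> a) ` carrier A"
  by (auto simp: quot_alg_def ring.defs module.defs FactRing_def A_RCOSETS_def')

lemma carrier_quot_algE:
  assumes "X \<in> carrier (quot_alg A I)"
  obtains a where "a \<in> carrier A" "X = I +> a"
  using assms unfolding carrier_quot_alg by blast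

lemma coset_in_quot_alg: "a \<in> carrier A \<Longrightarrow> I +> a \<in> carrier (quot_alg A I)"
  unfolding carrier_quot_alg by blast

lemma quot_alg_ops:
  "a \<in> carrier A \<Longrightarrow> b \<in> carrier A \<Longrightarrow> (I +> a) \<oplus>\<^bsub>quot_alg A I\<^esub> (I +> b) = I +> (a \<oplus> b)"
  "a \<in> carrier A \<Longrightarrow> b \<in> carrier A \<Longrightarrow> (I +> a) \<otimes>\<^bsub>quot_alg A I\<^esub> (I +> b) = I +> (a \<otimes> b)"
  "\<one>\<^bsub>quot_alg A I\<^esub> = I +> \<one>"
  "\<zero>\<^bsub>quot_alg A I\<^esub> = I"
  by (simp_all add: quot_alg_def ring.defs module.defs FactRing_def a_rcos_sum rcoset_mult_add)

lemma k_algebra_quot_alg: "k_algebra (quot_alg A I)"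
proof -
  have "ring (quot_alg A I)" unfolding quot_alg_def by (rule ring_extend[OF quotient_is_ring])
  show ?thesis
  proof (intro k_algebra.intro k_algebra_axioms.intro)
    show "ring (quot_alg A I)" by fact
  qed (auto elim!: carrier_quot_algE simp: quot_alg_ops quot_alg_smult coset_in_quot_alg
          smult_l_distr smult_r_distr smult_assoc smult_mult_l smult_mult_r)
qed

lemma quot_alg_proj: "(\<lambda>a. I +> a) \<in> alg_hom A (quot_alg A I)"
  by (rule alg_homI) (simp_all add: quot_alg_ops quot_alg_smult coset_in_quot_alg)

lemma quot_alg_proj_eq_zero: "a \<in> I \<Longrightarrow> I +> a = \<zero>\<^bsub>quot_alg A I\<^esub>"
  using a_rcos_zero[OF I] by (simp add: quot_alg_ops)

lemma quot_alg_factor: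
  assumes "k_algebra B" and h: "h \<in> alg_hom A B" and ker: "\<And>i. i \<in> I \<Longrightarrow> h i = \<zero>\<^bsub>B\<^esub>"
  shows "\<exists>f\<in>alg_hom (quot_alg A I) B. \<forall>a\<in>carrier A. f (I +> a) = h a"
proof -
  interpret B: k_algebra B by fact
  \<comment> \<open>A homomorphism that annihilates the ideal is constant on cosets.\<close>
  let ?f = "\<lambda>X. the_elem (h ` X)"
  have eq: "?f (I +> a) = h a" if a: "a \<in> carrier A" for a
  proof -
    have "h x = h a" if "x \<in> I +> a" for x
    proof -
      from that obtain i where i: "i \<in> I" "x = i \<oplus> a" by (auto simp: a_r_coset_def')
      then have "i \<in> carrier A" using a_subset by auto
      with i a show ?thesis using alg_hom_closed[OF h] by (simp add: alg_hom_add[OF h] ker)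
    qed
    then have "h ` (I +> a) = {h a}" using a_rcos_self[OF a] by blast
    then show ?thesis by simp
  qed
  have "?f \<in> alg_hom (quot_alg A I) B"
    by (rule alg_homI)
       (auto elim!: carrier_quot_algE simp: quot_alg_ops quot_alg_smult eq alg_hom_closed[OF h]
          alg_hom_mult[OF h] alg_hom_add[OF h] alg_hom_one[OF h] alg_hom_smult[OF h])
  then show ?thesis by (intro bexI[of _ ?f] ballI eq)
qed

end

text \<open>
  The kernel of \<open>h\<close> is an ideal, so it contains the ideal generated by any set of its elements.
\<close>

lemma quot_genideal_factor:
  assumes "R \<subseteq> carrier A" "k_algebra B" and h: "h \<in> alg_hom A B" and ker: "\<And>r. r \<in> R \<Longrightarrow> h r = \<zero>\<^bsub>B\<^esub>"
  shows "\<exists>f\<in>alg_hom (quot_alg A (Idl R)) B. \<forall>a\<in>carrier A. f (Idl R +> a) = h a"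
proof -
  interpret B: k_algebra B by fact
  have "ring_hom_ring A B h"
    by unfold_locales (use h in \<open>simp add: alg_hom_def\<close>)
  then have "ideal (a_kernel A B h) A" by (rule ring_hom_ring.kernel_is_ideal)
  moreover have "R \<subseteq> a_kernel A B h" using assms(1) ker by (auto simp: a_kernel_def')
  ultimately have "Idl R \<subseteq> a_kernel A B h" by (rule genideal_minimal)
  then have "h i = \<zero>\<^bsub>B\<^esub>" if "i \<in> Idl R" for i using that by (auto simp: a_kernel_def')
  then show ?thesis by (rule quot_alg_factor[OF genideal_ideal[OF assms(1)] assms(2) h])
qed

end

section \<open>Algebras given by generators and relations\<close>

context
  fixes S :: "'x set" and R :: "('x free_mon \<Rightarrow>\<^sub>0 'k::field) set"
  assumes R: "R \<subseteq> carrier (free_alg S)"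
begin

interpretation F: k_algebra "free_alg S :: ('k, 'x free_mon \<Rightarrow>\<^sub>0 'k) module"
  by (rule k_algebra_free_alg)

lemma k_algebra_presented_alg: "k_algebra (presented_alg S R)"
  unfolding presented_alg_def by (rule F.k_algebra_quot_alg[OF F.genideal_ideal[OF R]])

text \<open>
  The quotient map, with the facts about it that determine the presented algebra.  It hides the
  cosets from everything that follows.
\<close>

lemma presented_alg_proj:
  obtains \<pi> where "\<pi> \<in> alg_hom (free_alg S) (presented_alg S R)"
    "\<And>x. \<pi> (free_gen x) = presented_gen S R x" "\<And>r. r \<in> R \<Longrightarrow> \<pi> r = \<zero>\<^bsub>presented_alg S R\<^esub>"
    "carrier (presented_alg S R) = \<pi> ` carrier (free_alg S)"
proof
  let ?\<pi> = "\<lambda>p. (Idl\<^bsub>free_alg S\<^esub> R) +>\<^bsub>free_alg S\<^esub> p"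
  note I = F.genideal_ideal[OF R]
  show "?\<pi> \<in> alg_hom (free_alg S) (presented_alg S R)"
    unfolding presented_alg_def by (rule F.quot_alg_proj[OF I])
  show "?\<pi> (free_gen x) = presented_gen S R x" for x by (simp add: presented_gen_def)
  show "?\<pi> r = \<zero>\<^bsub>presented_alg S R\<^esub>" if "r \<in> R" for r
    unfolding presented_alg_def
    using F.quot_alg_proj_eq_zero[OF I] F.genideal_self[OF R] that by blast
  show "carrier (presented_alg S R) = ?\<pi> ` carrier (free_alg S)"
    unfolding presented_alg_def by (rule F.carrier_quot_alg[OF I])
qed

lemma presented_gen_closed: "x \<in> S \<Longrightarrow> presented_gen S R x \<in> carrier (presented_alg S R)"
proof (rule presented_alg_proj)
  fix \<pi> assume x: "x \<in> S" and \<pi>: "\<pi> \<in> alg_hom (free_alg S) (presented_alg S R)"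
    "\<And>x. \<pi> (free_gen x) = presented_gen S R x"
  show ?thesis using alg_hom_closed[OF \<pi>(1) free_gen_carrier[OF x]] by (simp add: \<pi>(2))
qed

text \<open>
  The evaluation at \<open>g\<close> is known only by its values on the generators, so the condition on the
  relations is imposed on all homomorphisms with these values; they agree on the free algebra.
\<close>

lemma presented_alg_universal:
  fixes B :: "('k, 'b) module"
  assumes B: "k_algebra B" and g: "\<And>x. x \<in> S \<Longrightarrow> g x \<in> carrier B"
    and rel: "\<And>h r. h \<in> alg_hom (free_alg S) B \<Longrightarrow> (\<And>x. x \<in> S \<Longrightarrow> h (free_gen x) = g x) \<Longrightarrow> r \<in> R \<Longrightarrow> h r = \<zero>\<^bsub>B\<^esub>"
  shows "\<exists>f\<in>alg_hom (presented_alg S R) B. \<forall>x\<in>S. f (presented_gen S R x) = g x"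
proof -
  obtain h where h: "h \<in> alg_hom (free_alg S) B" "\<And>x. x \<in> S \<Longrightarrow> h (free_gen x) = g x"
    using free_alg_universal[where S = S and g = g, OF B g] by blast
  have "\<exists>f\<in>alg_hom (presented_alg S R) B. \<forall>p\<in>carrier (free_alg S).
      f ((Idl\<^bsub>free_alg S\<^esub> R) +>\<^bsub>free_alg S\<^esub> p) = h p"
    unfolding presented_alg_def by (rule F.quot_genideal_factor[OF R B h(1) rel[OF h]])
  then obtain f where "f \<in> alg_hom (presented_alg S R) B"
    "\<forall>p\<in>carrier (free_alg S). f ((Idl\<^bsub>free_alg S\<^esub> R) +>\<^bsub>free_alg S\<^esub> p) = h p" by blast
  with h(2) show ?thesis by (intro bexI[of _ f]) (simp_all add: presented_gen_def)
qed

lemma presented_alg_hom_eqI: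
  fixes B :: "('k, 'b) module"
  assumes B: "k_algebra B" and f: "f \<in> alg_hom (presented_alg S R) B" and g: "g \<in> alg_hom (presented_alg S R) B"
    and gen: "\<And>x. x \<in> S \<Longrightarrow> f (presented_gen S R x) = g (presented_gen S R x)"
    and y: "y \<in> carrier (presented_alg S R)"
  shows "f y = g y"
proof (rule presented_alg_proj)
  fix \<pi> assume \<pi>: "\<pi> \<in> alg_hom (free_alg S) (presented_alg S R)"
    "\<And>x. \<pi> (free_gen x) = presented_gen S R x"
    "carrier (presented_alg S R) = \<pi> ` carrier (free_alg S)"
  from y \<pi>(3) obtain p where p: "p \<in> carrier (free_alg S)" "y = \<pi> p" by auto
  have "(f \<circ> \<pi>) p = (g \<circ> \<pi>) p"
    by (rule free_alg_hom_eqI[OF B alg_hom_comp[OF \<pi>(1) f] alg_hom_comp[OF \<pi>(1) g] _ p(1)])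
       (simp add: \<pi>(2) gen)
  with p show ?thesis by simp
qed

end

section \<open>Clifford maps\<close>

text \<open>
  The linear maps \<open>\<phi>\<close> from \<open>V\<close> into an algebra for which the Clifford algebra of \<open>(V, q)\<close> is universal.
\<close>

definition clifford_map ::
  "('k::field, 'v) module \<Rightarrow> ('v \<Rightarrow> 'k) \<Rightarrow> ('k, 'b) module \<Rightarrow> ('v \<Rightarrow> 'b) \<Rightarrow> bool" where
  "clifford_map V q B \<phi> \<longleftrightarrow>
    (\<forall>v\<in>carrier V. \<phi> v \<in> carrier B) \<and>
    (\<forall>u\<in>carrier V. \<forall>v\<in>carrier V. \<phi> (u \<oplus>\<^bsub>V\<^esub> v) = \<phi> u \<oplus>\<^bsub>B\<^esub> \<phi> v) \<and>
    (\<forall>c. \<forall>v\<in>carrier V. \<phi> (c \<odot>\<^bsub>V\<^esub> v) = c \<odot>\<^bsub>B\<^esub> \<phi> v) \<and>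
    (\<forall>v\<in>carrier V. \<phi> v \<otimes>\<^bsub>B\<^esub> \<phi> v = q v \<odot>\<^bsub>B\<^esub> \<one>\<^bsub>B\<^esub>)"

lemma clifford_mapD:
  assumes "clifford_map V q B \<phi>"
  shows "v \<in> carrier V \<Longrightarrow> \<phi> v \<in> carrier B"
    and "u \<in> carrier V \<Longrightarrow> v \<in> carrier V \<Longrightarrow> \<phi> (u \<oplus>\<^bsub>V\<^esub> v) = \<phi> u \<oplus>\<^bsub>B\<^esub> \<phi> v"
    and "v \<in> carrier V \<Longrightarrow> \<phi> (c \<odot>\<^bsub>V\<^esub> v) = c \<odot>\<^bsub>B\<^esub> \<phi> v"
    and "v \<in> carrier V \<Longrightarrow> \<phi> v \<otimes>\<^bsub>B\<^esub> \<phi> v = q v \<odot>\<^bsub>B\<^esub> \<one>\<^bsub>B\<^esub>"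
  using assms by (auto simp: clifford_map_def)

lemma (in k_algebra) minus_add_cancel: "x \<in> carrier A \<Longrightarrow> y \<in> carrier A \<Longrightarrow> (x \<ominus> y) \<oplus> y = x"
  by (simp add: minus_eq a_assoc l_neg)

lemma (in k_algebra) minus_eq_zero_iff:
  assumes "x \<in> carrier A" "y \<in> carrier A"
  shows "x \<ominus> y = \<zero> \<longleftrightarrow> x = y"
  using minus_add_cancel[OF assms] assms by (auto simp: minus_eq r_neg)

text \<open>
  Expand \<open>\<phi>(u + v)\<^sup>2 = q(u + v) 1\<close> and cancel the squares.
\<close>

lemma (in k_algebra) clifford_map_polar:
  assumes \<phi>: "clifford_map V q A \<phi>"
    and u: "u \<in> carrier V" and v: "v \<in> carrier V" and uv: "u \<oplus>\<^bsub>V\<^esub> v \<in> carrier V"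
  shows "\<phi> u \<otimes> \<phi> v \<oplus> \<phi> v \<otimes> \<phi> u = polar_form V q u v \<odot> \<one>"
proof -
  have c: "\<phi> u \<in> carrier A" "\<phi> v \<in> carrier A" using clifford_mapD(1)[OF \<phi>] u v by auto
  have "q (u \<oplus>\<^bsub>V\<^esub> v) \<odot> \<one> = (\<phi> u \<oplus> \<phi> v) \<otimes> (\<phi> u \<oplus> \<phi> v)"
    using clifford_mapD(4)[OF \<phi> uv] clifford_mapD(2)[OF \<phi> u v] by simp
  also have "\<dots> = (\<phi> u \<otimes> \<phi> v \<oplus> \<phi> v \<otimes> \<phi> u) \<oplus> (\<phi> u \<otimes> \<phi> u \<oplus> \<phi> v \<otimes> \<phi> v)"
    using c by (simp add: l_distr r_distr a_ac)
  also have "\<phi> u \<otimes> \<phi> u \<oplus> \<phi> v \<otimes> \<phi> v = (q u + q v) \<odot> \<one>"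
    using clifford_mapD(4)[OF \<phi> u] clifford_mapD(4)[OF \<phi> v] by (simp add: smult_l_distr)
  finally have e: "q (u \<oplus>\<^bsub>V\<^esub> v) \<odot> \<one> = (\<phi> u \<otimes> \<phi> v \<oplus> \<phi> v \<otimes> \<phi> u) \<oplus> (q u + q v) \<odot> \<one>" .
  have "polar_form V q u v \<odot> \<one> \<oplus> (q u + q v) \<odot> \<one> = q (u \<oplus>\<^bsub>V\<^esub> v) \<odot> \<one>"
    by (simp add: polar_form_def flip: smult_l_distr)
  with e show ?thesis using c by (metis add.right_cancel add.m_closed m_closed one_closed smult_closed)
qed

section \<open>The universal property of the Clifford algebra\<close>

definition clifford_rels :: "('k::field, 'v) module \<Rightarrow> ('v \<Rightarrow> 'k) \<Rightarrow> ('v free_mon \<Rightarrow>\<^sub>0 'k) set set" where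
  "clifford_rels V q =
    {tensor_embed V v \<otimes>\<^bsub>tensor_alg V\<^esub> tensor_embed V v
       \<ominus>\<^bsub>tensor_alg V\<^esub> q v \<odot>\<^bsub>tensor_alg V\<^esub> \<one>\<^bsub>tensor_alg V\<^esub> | v. v \<in> carrier V}"

definition clifford_embed ::
  "('k::field, 'v) module \<Rightarrow> ('v \<Rightarrow> 'k) \<Rightarrow> 'v \<Rightarrow> ('v free_mon \<Rightarrow>\<^sub>0 'k) set set" where
  "clifford_embed V q v =
    Idl\<^bsub>tensor_alg V\<^esub> (clifford_rels V q) +>\<^bsub>tensor_alg V\<^esub> tensor_embed V v"

lemma clifford_alg_eq: "clifford_alg V q = quot_alg (tensor_alg V) (Idl\<^bsub>tensor_alg V\<^esub> (clifford_rels V q))"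
  by (simp add: clifford_alg_def clifford_rels_def Let_def)

context
  fixes V :: "('k::field, 'v) module" and q :: "'v \<Rightarrow> 'k"
  assumes V_add: "\<And>u v. u \<in> carrier V \<Longrightarrow> v \<in> carrier V \<Longrightarrow> u \<oplus>\<^bsub>V\<^esub> v \<in> carrier V"
    and V_smult: "\<And>c v. v \<in> carrier V \<Longrightarrow> c \<odot>\<^bsub>V\<^esub> v \<in> carrier V"
begin

lemma tensor_rels_carrier: "tensor_rels V \<subseteq> carrier (free_alg (carrier V))"
  by (auto simp: tensor_rels_def V_add V_smult)

interpretation T: k_algebra "tensor_alg V"
  unfolding tensor_alg_def by (rule k_algebra_presented_alg[OF tensor_rels_carrier])

lemma tensor_embed_closed: "v \<in> carrier V \<Longrightarrow> tensor_embed V v \<in> carrier (tensor_alg V)"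
  unfolding tensor_embed_def tensor_alg_def by (rule presented_gen_closed[OF tensor_rels_carrier])

text \<open>
  The linearity relations are among the relations of the tensor algebra, so the quotient map
  annihilates them.
\<close>

lemma tensor_embed_linear:
  "u \<in> carrier V \<Longrightarrow> v \<in> carrier V \<Longrightarrow>
    tensor_embed V (u \<oplus>\<^bsub>V\<^esub> v) = tensor_embed V u \<oplus>\<^bsub>tensor_alg V\<^esub> tensor_embed V v" (is "_ \<Longrightarrow> _ \<Longrightarrow> ?add")
  "v \<in> carrier V \<Longrightarrow>
    tensor_embed V (c \<odot>\<^bsub>V\<^esub> v) = c \<odot>\<^bsub>tensor_alg V\<^esub> tensor_embed V v" (is "_ \<Longrightarrow> ?smult")
proof -
  show ?add if u: "u \<in> carrier V" and v: "v \<in> carrier V"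
  proof (rule presented_alg_proj[OF tensor_rels_carrier])
    fix \<pi> assume "\<pi> \<in> alg_hom (free_alg (carrier V)) (presented_alg (carrier V) (tensor_rels V))"
      and gen: "\<And>x. \<pi> (free_gen x) = presented_gen (carrier V) (tensor_rels V) x"
      and rel: "\<And>r. r \<in> tensor_rels V \<Longrightarrow> \<pi> r = \<zero>\<^bsub>presented_alg (carrier V) (tensor_rels V)\<^esub>"
    then have \<pi>: "\<pi> \<in> alg_hom (free_alg (carrier V)) (tensor_alg V)" by (simp add: tensor_alg_def)
    note ops = alg_hom_free_ops[OF T.k_algebra_axioms \<pi>]
    have "\<pi> (free_gen (u \<oplus>\<^bsub>V\<^esub> v) - free_gen u - free_gen v) = \<zero>\<^bsub>tensor_alg V\<^esub>"
      using rel u v unfolding tensor_alg_def tensor_rels_def by blast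
    then have "(tensor_embed V (u \<oplus>\<^bsub>V\<^esub> v) \<ominus>\<^bsub>tensor_alg V\<^esub> tensor_embed V u)
        \<ominus>\<^bsub>tensor_alg V\<^esub> tensor_embed V v = \<zero>\<^bsub>tensor_alg V\<^esub>"
      using u v by (simp add: ops gen V_add flip: tensor_embed_def)
    then have "tensor_embed V (u \<oplus>\<^bsub>V\<^esub> v) \<ominus>\<^bsub>tensor_alg V\<^esub> tensor_embed V u = tensor_embed V v"
      using u v by (simp add: T.minus_eq_zero_iff tensor_embed_closed V_add)
    then show ?add
      using T.minus_add_cancel[OF tensor_embed_closed[OF V_add[OF u v]] tensor_embed_closed[OF u]]
      by (simp add: T.a_comm tensor_embed_closed u v)
  qed
  show ?smult if v: "v \<in> carrier V"
  proof (rule presented_alg_proj[OF tensor_rels_carrier])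
    fix \<pi> assume "\<pi> \<in> alg_hom (free_alg (carrier V)) (presented_alg (carrier V) (tensor_rels V))"
      and gen: "\<And>x. \<pi> (free_gen x) = presented_gen (carrier V) (tensor_rels V) x"
      and rel: "\<And>r. r \<in> tensor_rels V \<Longrightarrow> \<pi> r = \<zero>\<^bsub>presented_alg (carrier V) (tensor_rels V)\<^esub>"
    then have \<pi>: "\<pi> \<in> alg_hom (free_alg (carrier V)) (tensor_alg V)" by (simp add: tensor_alg_def)
    note ops = alg_hom_free_ops[OF T.k_algebra_axioms \<pi>]
    have "\<pi> (free_gen (c \<odot>\<^bsub>V\<^esub> v) - free_const c * free_gen v) = \<zero>\<^bsub>tensor_alg V\<^esub>"
      using rel v unfolding tensor_alg_def tensor_rels_def by blast
    then show ?smult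
      using v by (simp add: ops gen V_smult T.smult_mult_l T.minus_eq_zero_iff tensor_embed_closed flip: tensor_embed_def)
  qed
qed

lemma tensor_alg_universal:
  fixes B :: "('k, 'b) module"
  assumes "k_algebra B" and \<phi>: "\<And>v. v \<in> carrier V \<Longrightarrow> \<phi> v \<in> carrier B"
    and add: "\<And>u v. u \<in> carrier V \<Longrightarrow> v \<in> carrier V \<Longrightarrow> \<phi> (u \<oplus>\<^bsub>V\<^esub> v) = \<phi> u \<oplus>\<^bsub>B\<^esub> \<phi> v"
    and smult: "\<And>c v. v \<in> carrier V \<Longrightarrow> \<phi> (c \<odot>\<^bsub>V\<^esub> v) = c \<odot>\<^bsub>B\<^esub> \<phi> v"
  shows "\<exists>h\<in>alg_hom (tensor_alg V) B. \<forall>v\<in>carrier V. h (tensor_embed V v) = \<phi> v"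
  unfolding tensor_alg_def tensor_embed_def
proof (rule presented_alg_universal[OF tensor_rels_carrier assms(1) \<phi>])
  interpret B: k_algebra B by fact
  fix h r assume h: "h \<in> alg_hom (free_alg (carrier V)) B"
    and gen: "\<And>x. x \<in> carrier V \<Longrightarrow> h (free_gen x) = \<phi> x" and r: "r \<in> tensor_rels V"
  note ops = alg_hom_free_ops[OF assms(1) h]
  have "(x \<oplus>\<^bsub>B\<^esub> y) \<ominus>\<^bsub>B\<^esub> x \<ominus>\<^bsub>B\<^esub> y = \<zero>\<^bsub>B\<^esub>" if "x \<in> carrier B" "y \<in> carrier B" for x y
  proof -
    have "(x \<oplus>\<^bsub>B\<^esub> y) \<ominus>\<^bsub>B\<^esub> x = y \<oplus>\<^bsub>B\<^esub> (x \<ominus>\<^bsub>B\<^esub> x)"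
      using that by (simp add: B.minus_eq B.a_ac)
    then show ?thesis using that by (simp add: B.minus_eq_zero_iff)
  qed
  with r \<phi> show "h r = \<zero>\<^bsub>B\<^esub>"
    unfolding tensor_rels_def
    by (auto simp: ops gen V_add V_smult add smult B.smult_mult_l B.minus_eq_zero_iff)
qed

lemma clifford_rels_carrier: "clifford_rels V q \<subseteq> carrier (tensor_alg V)"
  by (auto simp: clifford_rels_def tensor_embed_closed)

lemma k_algebra_clifford_alg: "k_algebra (clifford_alg V q)"
  unfolding clifford_alg_eq
  by (rule T.k_algebra_quot_alg[OF T.genideal_ideal[OF clifford_rels_carrier]])

lemma clifford_map_clifford_embed: "clifford_map V q (clifford_alg V q) (clifford_embed V q)"
proof -
  interpret C: k_algebra "clifford_alg V q" by (rule k_algebra_clifford_alg)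
  let ?\<pi> = "\<lambda>x. Idl\<^bsub>tensor_alg V\<^esub> (clifford_rels V q) +>\<^bsub>tensor_alg V\<^esub> x"
  note I = T.genideal_ideal[OF clifford_rels_carrier]
  have \<pi>: "?\<pi> \<in> alg_hom (tensor_alg V) (clifford_alg V q)"
    unfolding clifford_alg_eq by (rule T.quot_alg_proj[OF I])
  have sq: "clifford_embed V q v \<otimes>\<^bsub>clifford_alg V q\<^esub> clifford_embed V q v
      = q v \<odot>\<^bsub>clifford_alg V q\<^esub> \<one>\<^bsub>clifford_alg V q\<^esub>" if v: "v \<in> carrier V" for v
  proof -
    let ?t = "tensor_embed V v"
    have t: "?t \<in> carrier (tensor_alg V)" using v by (rule tensor_embed_closed)
    have "?t \<otimes>\<^bsub>tensor_alg V\<^esub> ?t \<ominus>\<^bsub>tensor_alg V\<^esub> q v \<odot>\<^bsub>tensor_alg V\<^esub> \<one>\<^bsub>tensor_alg V\<^esub> \<in> clifford_rels V q"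
      using v by (auto simp: clifford_rels_def)
    then have "?\<pi> (?t \<otimes>\<^bsub>tensor_alg V\<^esub> ?t \<ominus>\<^bsub>tensor_alg V\<^esub> q v \<odot>\<^bsub>tensor_alg V\<^esub> \<one>\<^bsub>tensor_alg V\<^esub>) = \<zero>\<^bsub>clifford_alg V q\<^esub>"
      unfolding clifford_alg_eq
      using T.quot_alg_proj_eq_zero[OF I] T.genideal_self[OF clifford_rels_carrier] by blast
    then have "?\<pi> ?t \<otimes>\<^bsub>clifford_alg V q\<^esub> ?\<pi> ?t \<ominus>\<^bsub>clifford_alg V q\<^esub> q v \<odot>\<^bsub>clifford_alg V q\<^esub> \<one>\<^bsub>clifford_alg V q\<^esub> = \<zero>\<^bsub>clifford_alg V q\<^esub>"
      using t by (simp add: alg_hom_minus[OF T.k_algebra_axioms C.k_algebra_axioms \<pi>]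
          alg_hom_mult[OF \<pi>] alg_hom_smult[OF \<pi>] alg_hom_one[OF \<pi>])
    then show ?thesis
      using alg_hom_closed[OF \<pi> t] by (simp add: clifford_embed_def C.minus_eq_zero_iff)
  qed
  show ?thesis
    unfolding clifford_map_def
  proof (intro conjI ballI allI)
    fix u v c assume u: "u \<in> carrier V" and v: "v \<in> carrier V"
    note uv = tensor_embed_closed[OF u] tensor_embed_closed[OF v]
    show "clifford_embed V q (u \<oplus>\<^bsub>V\<^esub> v)
        = clifford_embed V q u \<oplus>\<^bsub>clifford_alg V q\<^esub> clifford_embed V q v"
      unfolding clifford_embed_def tensor_embed_linear(1)[OF u v] by (rule alg_hom_add[OF \<pi> uv])
  next
    fix v c assume v: "v \<in> carrier V"
    note t = tensor_embed_closed[OF v]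
    show "clifford_embed V q v \<in> carrier (clifford_alg V q)"
      unfolding clifford_embed_def by (rule alg_hom_closed[OF \<pi> t])
    show "clifford_embed V q (c \<odot>\<^bsub>V\<^esub> v) = c \<odot>\<^bsub>clifford_alg V q\<^esub> clifford_embed V q v"
      unfolding clifford_embed_def tensor_embed_linear(2)[OF v] by (rule alg_hom_smult[OF \<pi> t])
  qed (rule sq)
qed

text \<open>
  A linear map extends to the tensor algebra, and the extension annihilates the relations
  \<open>v \<otimes> v - q(v) 1\<close> precisely because the map is a Clifford map.
\<close>

lemma clifford_alg_universal:
  fixes B :: "('k, 'b) module"
  assumes B: "k_algebra B" and \<phi>: "clifford_map V q B \<phi>"
  shows "\<exists>h\<in>alg_hom (clifford_alg V q) B. \<forall>v\<in>carrier V. h (clifford_embed V q v) = \<phi> v"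
proof -
  interpret B: k_algebra B by fact
  obtain g where g: "g \<in> alg_hom (tensor_alg V) B" "\<forall>v\<in>carrier V. g (tensor_embed V v) = \<phi> v"
    using tensor_alg_universal[OF B clifford_mapD(1-3)[OF \<phi>]] by blast
  have "g r = \<zero>\<^bsub>B\<^esub>" if "r \<in> clifford_rels V q" for r
    using that g(2) clifford_mapD(1)[OF \<phi>] clifford_mapD(4)[OF \<phi>] unfolding clifford_rels_def
    by (auto simp: alg_hom_minus[OF T.k_algebra_axioms B g(1)] tensor_embed_closed B.minus_eq_zero_iff
        alg_hom_mult[OF g(1)] alg_hom_smult[OF g(1)] alg_hom_one[OF g(1)])
  from T.quot_genideal_factor[OF clifford_rels_carrier B g(1) this]
  obtain f where "f \<in> alg_hom (clifford_alg V q) B" "\<forall>x\<in>carrier (tensor_alg V).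
      f (Idl\<^bsub>tensor_alg V\<^esub> (clifford_rels V q) +>\<^bsub>tensor_alg V\<^esub> x) = g x"
    unfolding clifford_alg_eq by blast
  with g(2) show ?thesis
    by (intro bexI[of _ f]) (simp_all add: clifford_embed_def tensor_embed_closed)
qed

lemma clifford_alg_hom_eqI:
  fixes B :: "('k, 'b) module"
  assumes B: "k_algebra B" and f: "f \<in> alg_hom (clifford_alg V q) B" and g: "g \<in> alg_hom (clifford_alg V q) B"
    and gen: "\<And>v. v \<in> carrier V \<Longrightarrow> f (clifford_embed V q v) = g (clifford_embed V q v)"
    and y: "y \<in> carrier (clifford_alg V q)"
  shows "f y = g y"
proof -
  let ?\<pi> = "\<lambda>x. Idl\<^bsub>tensor_alg V\<^esub> (clifford_rels V q) +>\<^bsub>tensor_alg V\<^esub> x"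
  note I = T.genideal_ideal[OF clifford_rels_carrier]
  have \<pi>: "?\<pi> \<in> alg_hom (presented_alg (carrier V) (tensor_rels V)) (clifford_alg V q)"
    unfolding clifford_alg_eq using T.quot_alg_proj[OF I] by (simp add: tensor_alg_def)
  obtain x where x: "x \<in> carrier (presented_alg (carrier V) (tensor_rels V))" "y = ?\<pi> x"
    using y unfolding clifford_alg_eq T.carrier_quot_alg[OF I] by (auto simp: tensor_alg_def)
  have "(f \<circ> ?\<pi>) x = (g \<circ> ?\<pi>) x"
    by (rule presented_alg_hom_eqI[OF tensor_rels_carrier B alg_hom_comp[OF \<pi> f] alg_hom_comp[OF \<pi> g] _ x(1)])
       (use gen in \<open>simp add: clifford_embed_def tensor_embed_def\<close>)
  with x(2) show ?thesis by simp
qed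

end

section \<open>Clifford maps on coordinate spaces\<close>

definition quad_form :: "'k::field mat \<Rightarrow> 'k vec \<Rightarrow> 'k" where
  "quad_form M v = v \<bullet> (M *\<^sub>v v)"

lemma polar_quad_form:
  fixes M :: "'k::field mat"
  assumes M: "M \<in> carrier_mat m m" "transpose_mat M = M" and u: "u \<in> carrier_vec m" and v: "v \<in> carrier_vec m"
  shows "polar_form (module_vec TYPE('k) m) (quad_form M) u v = 2 * (u \<bullet> (M *\<^sub>v v))"
proof -
  have Mu: "M *\<^sub>v u \<in> carrier_vec m" and Mv: "M *\<^sub>v v \<in> carrier_vec m"
    using M(1) u v by auto
  have "v \<bullet> (M *\<^sub>v u) = (M *\<^sub>v v) \<bullet> u"
    using transpose_vec_mult_scalar[OF M(1) u v] M(2) by simp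
  also have "\<dots> = u \<bullet> (M *\<^sub>v v)" by (rule comm_scalar_prod[OF Mv u])
  finally have sym: "v \<bullet> (M *\<^sub>v u) = u \<bullet> (M *\<^sub>v v)" .
  have "quad_form M (u + v) = quad_form M u + quad_form M v + 2 * (u \<bullet> (M *\<^sub>v v))"
    unfolding quad_form_def mult_add_distrib_mat_vec[OF M(1) u v]
      add_scalar_prod_distrib[OF u v add_carrier_vec[OF Mu Mv]]
      scalar_prod_add_distrib[OF u Mu Mv] scalar_prod_add_distrib[OF v Mu Mv] sym
    by simp
  then show ?thesis by (simp add: polar_form_def module_vec_simps)
qed

text \<open>
  The images of the unit vectors under a Clifford map for the quadratic form of \<open>M\<close>.  The
  relations are imposed for all pairs of indices, so the case \<open>i = j\<close> is twice the relation
  \<open>y\<^sub>i\<^sup>2 = M\<^sub>i\<^sub>i 1\<close>.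
\<close>

definition clifford_family :: "nat \<Rightarrow> 'k::field mat \<Rightarrow> ('k, 'b) module \<Rightarrow> (nat \<Rightarrow> 'b) \<Rightarrow> bool" where
  "clifford_family n M B y \<longleftrightarrow>
    (\<forall>i\<le>n. y i \<in> carrier B) \<and>
    (\<forall>i\<le>n. \<forall>j\<le>n. y i \<otimes>\<^bsub>B\<^esub> y j \<oplus>\<^bsub>B\<^esub> y j \<otimes>\<^bsub>B\<^esub> y i = (2 * M $$ (i, j)) \<odot>\<^bsub>B\<^esub> \<one>\<^bsub>B\<^esub>)"

context k_algebra
begin

definition lin_comb :: "nat \<Rightarrow> (nat \<Rightarrow> 'a) \<Rightarrow> 'k vec \<Rightarrow> 'a" where
  "lin_comb n y v = (\<Oplus>i\<in>{0..n}. v $ i \<odot> y i)"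

lemma lin_comb_closed:
  "(\<And>i. i \<le> n \<Longrightarrow> y i \<in> carrier A) \<Longrightarrow> lin_comb n y v \<in> carrier A"
  unfolding lin_comb_def by (rule finsum_closed) auto

lemma lin_comb_add:
  assumes "\<And>i. i \<le> n \<Longrightarrow> y i \<in> carrier A" "u \<in> carrier_vec (n + 1)" "v \<in> carrier_vec (n + 1)"
  shows "lin_comb n y (u + v) = lin_comb n y u \<oplus> lin_comb n y v"
proof -
  have "lin_comb n y (u + v) = (\<Oplus>i\<in>{0..n}. u $ i \<odot> y i \<oplus> v $ i \<odot> y i)"
    unfolding lin_comb_def by (rule finsum_cong') (use assms in \<open>auto simp: smult_l_distr\<close>)
  also have "\<dots> = lin_comb n y u \<oplus> lin_comb n y v"
    unfolding lin_comb_def by (rule finsum_addf) (use assms(1) in auto)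
  finally show ?thesis .
qed

lemma lin_comb_smult:
  assumes "\<And>i. i \<le> n \<Longrightarrow> y i \<in> carrier A" "v \<in> carrier_vec (n + 1)"
  shows "lin_comb n y (c \<cdot>\<^sub>v v) = c \<odot> lin_comb n y v"
proof -
  have "lin_comb n y (c \<cdot>\<^sub>v v) = (\<Oplus>i\<in>{0..n}. c \<odot> (v $ i \<odot> y i))"
    unfolding lin_comb_def by (rule finsum_cong') (use assms in \<open>auto simp: smult_assoc\<close>)
  also have "\<dots> = c \<odot> lin_comb n y v"
    unfolding lin_comb_def by (rule finsum_smult[symmetric]) (use assms(1) in auto)
  finally show ?thesis .
qed

text \<open>
  The anticommutator with a fixed element is linear.  Using this twice, once in each argument,
  gives the anticommutator of two linear combinations.
\<close>

lemma anticomm_finsum: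
  assumes "finite F" "x \<in> carrier A" "\<And>i. i \<in> F \<Longrightarrow> y i \<in> carrier A"
    and "\<And>i. i \<in> F \<Longrightarrow> x \<otimes> y i \<oplus> y i \<otimes> x = m i \<odot> \<one>"
  shows "x \<otimes> (\<Oplus>i\<in>F. c i \<odot> y i) \<oplus> (\<Oplus>i\<in>F. c i \<odot> y i) \<otimes> x = (\<Sum>i\<in>F. c i * m i) \<odot> \<one>"
  using assms(1,3,4)
proof (induction F rule: finite_induct)
  case empty
  then show ?case using assms(2) by simp
next
  case (insert i F)
  let ?S = "\<Oplus>i\<in>F. c i \<odot> y i"
  have cl: "?S \<in> carrier A" "y i \<in> carrier A" using insert.prems by (auto intro!: finsum_closed)
  have "(\<Oplus>i\<in>insert i F. c i \<odot> y i) = c i \<odot> y i \<oplus> ?S"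
    using insert by (subst finsum_insert) auto
  then have "x \<otimes> (\<Oplus>i\<in>insert i F. c i \<odot> y i) \<oplus> (\<Oplus>i\<in>insert i F. c i \<odot> y i) \<otimes> x
      = c i \<odot> (x \<otimes> y i \<oplus> y i \<otimes> x) \<oplus> (x \<otimes> ?S \<oplus> ?S \<otimes> x)"
    using cl assms(2) by (simp add: l_distr r_distr smult_mult_l smult_mult_r smult_r_distr a_ac)
  also have "\<dots> = (\<Sum>i\<in>insert i F. c i * m i) \<odot> \<one>"
    using insert by (simp add: smult_l_distr smult_assoc)
  finally show ?case .
qed

text \<open>
  An anticommutator of an element with itself is twice its square, so squares can be read off from
  anticommutators only if \<open>2\<close> is invertible.
\<close>

lemma smult_cancel_two:
  assumes "(2::'k) \<noteq> 0" "x \<in> carrier A" "x \<oplus> x = (2 * c) \<odot> \<one>"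
  shows "x = c \<odot> \<one>"
proof -
  have "2 \<odot> x = 2 \<odot> (c \<odot> \<one>)"
    using smult_l_distr[OF assms(2), of 1 1] assms(2,3) by (simp add: smult_assoc)
  then have "(inverse 2 * 2) \<odot> x = (inverse 2 * 2) \<odot> (c \<odot> \<one>)"
    using assms(2) by (simp only: smult_assoc smult_closed one_closed)
  then show ?thesis using assms(1,2) by simp
qed

lemma lin_comb_anticomm:
  assumes y: "clifford_family n M A y" and M: "M \<in> carrier_mat (n + 1) (n + 1)"
    and u: "u \<in> carrier_vec (n + 1)" and v: "v \<in> carrier_vec (n + 1)"
  shows "lin_comb n y u \<otimes> lin_comb n y v \<oplus> lin_comb n y v \<otimes> lin_comb n y u = (2 * (u \<bullet> (M *\<^sub>v v))) \<odot> \<one>"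
proof -
  have cl: "y i \<in> carrier A" if "i \<le> n" for i using y that by (simp add: clifford_family_def)
  have row: "y i \<otimes> lin_comb n y v \<oplus> lin_comb n y v \<otimes> y i = (\<Sum>j\<in>{0..n}. v $ j * (2 * M $$ (i, j))) \<odot> \<one>"
    if "i \<le> n" for i
    unfolding lin_comb_def
    by (rule anticomm_finsum) (use that y in \<open>auto simp: clifford_family_def\<close>)
  have "lin_comb n y v \<otimes> lin_comb n y u \<oplus> lin_comb n y u \<otimes> lin_comb n y v
      = (\<Sum>i\<in>{0..n}. u $ i * (\<Sum>j\<in>{0..n}. v $ j * (2 * M $$ (i, j)))) \<odot> \<one>"
    unfolding lin_comb_def[of n y u]
    by (rule anticomm_finsum) (use row cl lin_comb_closed[of n y v] in \<open>auto simp: a_comm\<close>)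
  also have "(\<Sum>i\<in>{0..n}. u $ i * (\<Sum>j\<in>{0..n}. v $ j * (2 * M $$ (i, j)))) = 2 * (u \<bullet> (M *\<^sub>v v))"
    using M u v
    by (simp add: scalar_prod_def sum_distrib_left atLeastLessThanSuc_atLeastAtMost mult_ac)
  finally show ?thesis
    using lin_comb_closed[of n y u] lin_comb_closed[of n y v] cl by (simp add: a_comm)
qed

text \<open>
  With \<open>clifford_family_clifford_map\<close> this is the correspondence between Clifford maps and families:
  the square of a linear combination is half of its anticommutator with itself.
\<close>

lemma clifford_map_lin_comb:
  assumes "(2::'k) \<noteq> 0" "clifford_family n M A y" "M \<in> carrier_mat (n + 1) (n + 1)"
  shows "clifford_map (module_vec TYPE('k) (n + 1)) (quad_form M) A (lin_comb n y)"
proof -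
  have cl: "y i \<in> carrier A" if "i \<le> n" for i using assms(2) that by (simp add: clifford_family_def)
  show ?thesis
    unfolding clifford_map_def module_vec_simps
  proof (intro conjI ballI allI)
    fix v :: "'k vec" assume v: "v \<in> carrier_vec (n + 1)"
    show lc: "lin_comb n y v \<in> carrier A" by (rule lin_comb_closed) (rule cl)
    show "lin_comb n y v \<otimes> lin_comb n y v = quad_form M v \<odot> \<one>"
      unfolding quad_form_def
      by (rule smult_cancel_two[OF assms(1) m_closed[OF lc lc] lin_comb_anticomm[OF assms(2,3) v v]])
  qed (simp_all add: lin_comb_add lin_comb_smult cl)
qed

text \<open>
  The vector is built up one coordinate at a time.  The quadratic form \<open>q\<close> is arbitrary, so that the
  lemma also applies to compositions of Clifford maps with linear maps.
\<close>

lemma clifford_map_eq_lin_comb: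
  assumes \<phi>: "clifford_map (module_vec TYPE('k) (n + 1)) q A \<phi>" and v: "v \<in> carrier_vec (n + 1)"
  shows "\<phi> v = lin_comb n (\<lambda>i. \<phi> (unit_vec (n + 1) i)) v"
proof -
  note D = clifford_mapD[OF \<phi>, simplified module_vec_simps]
  have "\<phi> (vec (n + 1) (\<lambda>i. if i < m then v $ i else 0)) = (\<Oplus>i\<in>{..<m}. v $ i \<odot> \<phi> (unit_vec (n + 1) i))"
    if "m \<le> n + 1" for m
    using that
  proof (induction m)
    case 0
    have "vec (n + 1) (\<lambda>i. if i < 0 then v $ i else 0) = 0 \<cdot>\<^sub>v (0\<^sub>v (n + 1))" by auto
    then have "\<phi> (vec (n + 1) (\<lambda>i. if i < 0 then v $ i else 0)) = 0 \<odot> \<phi> (0\<^sub>v (n + 1))"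
      by (metis D(3) zero_carrier_vec)
    then show ?case using D(1)[of "0\<^sub>v (n + 1)"] by simp
  next
    case (Suc m)
    have "vec (n + 1) (\<lambda>i. if i < Suc m then v $ i else 0)
        = v $ m \<cdot>\<^sub>v unit_vec (n + 1) m + vec (n + 1) (\<lambda>i. if i < m then v $ i else 0)"
      using Suc.prems by (intro eq_vecI) (auto simp: less_Suc_eq unit_vec_def)
    then have "\<phi> (vec (n + 1) (\<lambda>i. if i < Suc m then v $ i else 0))
        = v $ m \<odot> \<phi> (unit_vec (n + 1) m) \<oplus> \<phi> (vec (n + 1) (\<lambda>i. if i < m then v $ i else 0))"
      by (simp add: D(2,3))
    also have "\<dots> = (\<Oplus>i\<in>{..<Suc m}. v $ i \<odot> \<phi> (unit_vec (n + 1) i))"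
      unfolding lessThan_Suc using Suc D(1) by (subst finsum_insert) auto
    finally show ?case .
  qed
  from this[of "n + 1"] have "\<phi> (vec (n + 1) (\<lambda>i. if i < n + 1 then v $ i else 0)) = lin_comb n (\<lambda>i. \<phi> (unit_vec (n + 1) i)) v"
    by (simp add: lin_comb_def lessThan_Suc_atMost atLeast0AtMost)
  moreover have "vec (n + 1) (\<lambda>i. if i < n + 1 then v $ i else 0) = v" using v by auto
  ultimately show ?thesis by simp
qed

lemma clifford_family_cliff_map:
  assumes \<phi>: "clifford_map (module_vec TYPE('k) (n + 1)) (quad_form M) A \<phi>"
    and M: "M \<in> carrier_mat (n + 1) (n + 1)" "transpose_mat M = M"
  shows "clifford_family n M A (\<lambda>i. \<phi> (unit_vec (n + 1) i))"
  unfolding clifford_family_def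
proof (intro conjI allI impI)
  fix i j assume i: "i \<le> n" and j: "j \<le> n"
  have "unit_vec (n + 1) i \<bullet> (M *\<^sub>v unit_vec (n + 1) j) = M $$ (i, j)"
    using M(1) i j by simp
  then show "\<phi> (unit_vec (n + 1) i) \<otimes> \<phi> (unit_vec (n + 1) j) \<oplus> \<phi> (unit_vec (n + 1) j) \<otimes> \<phi> (unit_vec (n + 1) i)
      = (2 * M $$ (i, j)) \<odot> \<one>"
    using clifford_map_polar[OF \<phi>, unfolded module_vec_simps, of "unit_vec (n + 1) i" "unit_vec (n + 1) j"]
      polar_quad_form[OF M unit_vec_carrier unit_vec_carrier, of i j]
    by (simp only: unit_vec_carrier add_carrier_vec)
qed (use clifford_mapD(1)[OF \<phi>] in \<open>simp add: module_vec_simps\<close>)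

end

section \<open>The universal property of Clifford-type algebras\<close>

text \<open>
  One index set \<open>{0..n}\<close> for all generators, matching the rows and columns of the matrix.
\<close>

definition nth_gen :: "nat \<Rightarrow> cl_gen" where
  "nth_gen i = (if i = 0 then Gen_G else Gen_X i)"

lemma cl_gens_eq: "cl_gens n = nth_gen ` {..n}"
proof -
  have "{..n} = insert 0 {1..n}" by auto
  then show ?thesis by (auto simp: cl_gens_def nth_gen_def image_def)
qed

lemma cl_gens_carrier:
  "free_gen Gen_G \<in> carrier (free_alg (cl_gens n))"
  "i \<in> {1..n} \<Longrightarrow> free_gen (Gen_X i) \<in> carrier (free_alg (cl_gens n))"
  by (auto simp: cl_gens_def)

lemma cl_form_eq: "cl_form n \<alpha> \<beta> \<gamma> lam = quad_form (cl_matrix n \<alpha> \<beta> \<gamma> lam)"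
  by (rule ext) (simp add: cl_form_def quad_form_def)

lemma cl_matrix_carrier: "cl_matrix n \<alpha> \<beta> \<gamma> lam \<in> carrier_mat (n + 1) (n + 1)"
  by (simp add: cl_matrix_def)

lemma cl_matrix_symmetric: "transpose_mat (cl_matrix n \<alpha> \<beta> \<gamma> lam) = cl_matrix n \<alpha> \<beta> \<gamma> lam"
  by (rule eq_matI) (auto simp: cl_matrix_def)

locale clifford_type =
  fixes n :: nat and \<alpha> :: "'k::field" and \<beta> \<gamma> :: "nat \<Rightarrow> 'k" and lam :: "nat \<Rightarrow> nat \<Rightarrow> 'k"
  assumes two: "(2::'k) \<noteq> 0"
begin

abbreviation "A \<equiv> clifford_type_alg n \<alpha> \<beta> \<gamma> lam"
abbreviation "M \<equiv> cl_matrix n \<alpha> \<beta> \<gamma> lam"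
abbreviation "a \<equiv> \<lambda>i. clifford_type_gen n \<alpha> \<beta> \<gamma> lam (nth_gen i)"
abbreviation "\<iota> \<equiv> clifford_type_lin n \<alpha> \<beta> \<gamma> lam"
abbreviation "V \<equiv> module_vec TYPE('k) (n + 1)"

lemma two_cl_matrix:
  "2 * M $$ (0, 0) = 2 * \<alpha>"
  "i \<in> {1..n} \<Longrightarrow> 2 * M $$ (i, i) = 2 * \<beta> i"
  "i \<in> {1..n} \<Longrightarrow> 2 * M $$ (0, i) = \<gamma> i" "i \<in> {1..n} \<Longrightarrow> 2 * M $$ (i, 0) = \<gamma> i"
  "i \<in> {1..n} \<Longrightarrow> j \<in> {1..n} \<Longrightarrow> i < j \<Longrightarrow> 2 * M $$ (i, j) = lam i j"
  "i \<in> {1..n} \<Longrightarrow> j \<in> {1..n} \<Longrightarrow> i < j \<Longrightarrow> 2 * M $$ (j, i) = lam i j"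
  using two by (auto simp: cl_matrix_def)

lemma cl_rels_carrier: "cl_rels n \<alpha> \<beta> \<gamma> lam \<subseteq> carrier (free_alg (cl_gens n))"
  by (auto simp: cl_rels_def Let_def cl_gens_carrier)

interpretation A: k_algebra A
  unfolding clifford_type_alg_def by (rule k_algebra_presented_alg[OF cl_rels_carrier])

lemma k_algebra_clifford_type: "k_algebra A" by (rule A.k_algebra_axioms)

lemma clifford_type_gen_closed: "i \<le> n \<Longrightarrow> a i \<in> carrier A"
  unfolding clifford_type_alg_def clifford_type_gen_def
  by (rule presented_gen_closed[OF cl_rels_carrier]) (auto simp: cl_gens_eq)

text \<open>
  The defining relations give one equation for every unordered pair of indices.  The others follow,
  since the anticommutator and the matrix are both symmetric; on the diagonal one divides by \<open>2\<close>.
\<close>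

lemma clifford_family_iff_relations:
  fixes B :: "('k, 'b) module"
  assumes "k_algebra B" and y: "\<forall>i\<le>n. y i \<in> carrier B"
  shows "clifford_family n M B y \<longleftrightarrow>
    y 0 \<otimes>\<^bsub>B\<^esub> y 0 = \<alpha> \<odot>\<^bsub>B\<^esub> \<one>\<^bsub>B\<^esub> \<and>
    (\<forall>i\<in>{1..n}. y i \<otimes>\<^bsub>B\<^esub> y i = \<beta> i \<odot>\<^bsub>B\<^esub> \<one>\<^bsub>B\<^esub>) \<and>
    (\<forall>i\<in>{1..n}. y 0 \<otimes>\<^bsub>B\<^esub> y i \<oplus>\<^bsub>B\<^esub> y i \<otimes>\<^bsub>B\<^esub> y 0 = \<gamma> i \<odot>\<^bsub>B\<^esub> \<one>\<^bsub>B\<^esub>) \<and>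
    (\<forall>i\<in>{1..n}. \<forall>j\<in>{1..n}. i < j \<longrightarrow>
      y i \<otimes>\<^bsub>B\<^esub> y j \<oplus>\<^bsub>B\<^esub> y j \<otimes>\<^bsub>B\<^esub> y i = lam i j \<odot>\<^bsub>B\<^esub> \<one>\<^bsub>B\<^esub>)" (is "_ \<longleftrightarrow> ?rels")
proof -
  interpret B: k_algebra B by fact
  let ?P = "\<lambda>i j. y i \<otimes>\<^bsub>B\<^esub> y j \<oplus>\<^bsub>B\<^esub> y j \<otimes>\<^bsub>B\<^esub> y i = (2 * M $$ (i, j)) \<odot>\<^bsub>B\<^esub> \<one>\<^bsub>B\<^esub>"
  have diag: "x \<otimes>\<^bsub>B\<^esub> x \<oplus>\<^bsub>B\<^esub> x \<otimes>\<^bsub>B\<^esub> x = (2 * c) \<odot>\<^bsub>B\<^esub> \<one>\<^bsub>B\<^esub> \<longleftrightarrow> x \<otimes>\<^bsub>B\<^esub> x = c \<odot>\<^bsub>B\<^esub> \<one>\<^bsub>B\<^esub>"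
    if "x \<in> carrier B" for x c
  proof
    assume "x \<otimes>\<^bsub>B\<^esub> x \<oplus>\<^bsub>B\<^esub> x \<otimes>\<^bsub>B\<^esub> x = (2 * c) \<odot>\<^bsub>B\<^esub> \<one>\<^bsub>B\<^esub>"
    then show "x \<otimes>\<^bsub>B\<^esub> x = c \<odot>\<^bsub>B\<^esub> \<one>\<^bsub>B\<^esub>" by (rule B.smult_cancel_two[OF two B.m_closed[OF that that]])
  next
    assume "x \<otimes>\<^bsub>B\<^esub> x = c \<odot>\<^bsub>B\<^esub> \<one>\<^bsub>B\<^esub>"
    then show "x \<otimes>\<^bsub>B\<^esub> x \<oplus>\<^bsub>B\<^esub> x \<otimes>\<^bsub>B\<^esub> x = (2 * c) \<odot>\<^bsub>B\<^esub> \<one>\<^bsub>B\<^esub>"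
      by (simp only: mult_2 B.smult_l_distr[OF B.one_closed])
  qed
  have sym: "?P i j \<longleftrightarrow> ?P j i" if "i \<le> n" "j \<le> n" for i j
  proof -
    have "M $$ (i, j) = M $$ (j, i)"
      using that cl_matrix_carrier[of n \<alpha> \<beta> \<gamma> lam]
        arg_cong[OF cl_matrix_symmetric[of n \<alpha> \<beta> \<gamma> lam], of "\<lambda>N. N $$ (j, i)"]
      by simp
    then show ?thesis using y that by (simp add: B.a_comm)
  qed
  have "clifford_family n M B y \<longleftrightarrow> (\<forall>i\<le>n. \<forall>j\<le>n. ?P i j)"
    using y by (simp add: clifford_family_def)
  also have "\<dots> \<longleftrightarrow> (\<forall>i\<le>n. ?P i i) \<and> (\<forall>i\<le>n. \<forall>j\<le>n. i < j \<longrightarrow> ?P i j)"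
    using sym by (metis nat_neq_iff)
  also have "\<dots> \<longleftrightarrow> ?P 0 0 \<and> (\<forall>i\<in>{1..n}. ?P i i) \<and> (\<forall>i\<in>{1..n}. ?P 0 i) \<and>
      (\<forall>i\<in>{1..n}. \<forall>j\<in>{1..n}. i < j \<longrightarrow> ?P i j)"
  proof -
    have "(\<forall>i\<le>n. Q i) \<longleftrightarrow> Q 0 \<and> (\<forall>i\<in>{1..n}. Q i)" for Q :: "nat \<Rightarrow> bool"
      by (metis One_nat_def Suc_leI atLeastAtMost_iff le0 neq0_conv)
    then show ?thesis by auto
  qed
  also have "\<dots> \<longleftrightarrow> ?rels"
    using y by (simp add: two_cl_matrix diag)
  finally show ?thesis .
qed

lemma clifford_family_gens: "clifford_family n M A a"
proof -
  let ?P = "presented_alg (cl_gens n) (cl_rels n \<alpha> \<beta> \<gamma> lam)"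
  show ?thesis
  proof (rule presented_alg_proj[OF cl_rels_carrier])
    fix \<pi> assume "\<pi> \<in> alg_hom (free_alg (cl_gens n)) ?P"
      and gen: "\<And>x. \<pi> (free_gen x) = presented_gen (cl_gens n) (cl_rels n \<alpha> \<beta> \<gamma> lam) x"
      and rel: "\<And>r. r \<in> cl_rels n \<alpha> \<beta> \<gamma> lam \<Longrightarrow> \<pi> r = \<zero>\<^bsub>?P\<^esub>"
    then have \<pi>: "\<pi> \<in> alg_hom (free_alg (cl_gens n)) A" by (simp add: clifford_type_alg_def)
    have rel': "\<pi> r = \<zero>\<^bsub>A\<^esub>" if "r \<in> cl_rels n \<alpha> \<beta> \<gamma> lam" for r
      using rel[OF that] by (simp add: clifford_type_alg_def)
    note ops = alg_hom_free_ops[OF A.k_algebra_axioms \<pi>]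
    have g: "\<pi> (free_gen Gen_G) = a 0" "\<And>i. i \<in> {1..n} \<Longrightarrow> \<pi> (free_gen (Gen_X i)) = a i"
      by (simp_all add: gen clifford_type_gen_def nth_gen_def)
    have mem:
      "free_gen Gen_G * free_gen Gen_G - free_const \<alpha> \<in> cl_rels n \<alpha> \<beta> \<gamma> lam"
      "\<And>i. i \<in> {1..n} \<Longrightarrow> free_gen (Gen_X i) * free_gen (Gen_X i) - free_const (\<beta> i) \<in> cl_rels n \<alpha> \<beta> \<gamma> lam"
      "\<And>i. i \<in> {1..n} \<Longrightarrow> free_gen Gen_G * free_gen (Gen_X i) + free_gen (Gen_X i) * free_gen Gen_G
        - free_const (\<gamma> i) \<in> cl_rels n \<alpha> \<beta> \<gamma> lam"
      "\<And>i j. i \<in> {1..n} \<Longrightarrow> j \<in> {1..n} \<Longrightarrow> i < j \<Longrightarrow>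
        free_gen (Gen_X i) * free_gen (Gen_X j) + free_gen (Gen_X j) * free_gen (Gen_X i)
        - free_const (lam i j) \<in> cl_rels n \<alpha> \<beta> \<gamma> lam"
      unfolding cl_rels_def Let_def by blast+
    show ?thesis
      using mem[THEN rel'] clifford_family_iff_relations[OF A.k_algebra_axioms, of a]
      by (simp add: ops g cl_gens_carrier A.minus_eq_zero_iff clifford_type_gen_closed)
  qed
qed

lemma clifford_type_universal_family:
  fixes B :: "('k, 'b) module"
  assumes B: "k_algebra B" and y: "clifford_family n M B y"
  shows "\<exists>h\<in>alg_hom A B. \<forall>i\<le>n. h (a i) = y i"
proof -
  interpret B: k_algebra B by fact
  have cl: "i \<le> n \<Longrightarrow> y i \<in> carrier B" for i using y by (simp add: clifford_family_def)
  define g where "g x = (case x of Gen_G \<Rightarrow> y 0 | Gen_X i \<Rightarrow> y i)" for x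
  have g: "g (nth_gen i) = y i" for i by (simp add: g_def nth_gen_def)
  have "\<exists>h\<in>alg_hom A B. \<forall>x\<in>cl_gens n. h (clifford_type_gen n \<alpha> \<beta> \<gamma> lam x) = g x"
    unfolding clifford_type_alg_def clifford_type_gen_def
  proof (rule presented_alg_universal[OF cl_rels_carrier B])
    show "x \<in> cl_gens n \<Longrightarrow> g x \<in> carrier B" for x using cl by (auto simp: cl_gens_eq g)
    fix h r assume h: "h \<in> alg_hom (free_alg (cl_gens n)) B"
      and hg: "\<And>x. x \<in> cl_gens n \<Longrightarrow> h (free_gen x) = g x" and r: "r \<in> cl_rels n \<alpha> \<beta> \<gamma> lam"
    note ops = alg_hom_free_ops[OF B h]
    have hG: "h (free_gen Gen_G) = y 0" and hX: "\<And>i. i \<in> {1..n} \<Longrightarrow> h (free_gen (Gen_X i)) = y i"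
      using hg by (auto simp: cl_gens_def g_def)
    show "h r = \<zero>\<^bsub>B\<^esub>"
      using r clifford_family_iff_relations[OF B, of y] y
      by (auto simp: cl_rels_def Let_def ops hG hX cl_gens_carrier B.minus_eq_zero_iff cl)
  qed
  then show ?thesis by (auto simp: cl_gens_eq g)
qed

text \<open>
  Uniform indexing of the generators puts the linear map into the form to which the facts about
  families apply.
\<close>

lemma clifford_type_lin_eq: "\<iota> v = A.lin_comb n a v"
proof -
  have "{0..n} = insert 0 {1..n}" by auto
  moreover have "a i \<in> carrier A" if "i \<in> insert 0 {1..n}" for i
    using that clifford_type_gen_closed[of i] by auto
  ultimately have "A.lin_comb n a v = v $ 0 \<odot>\<^bsub>A\<^esub> a 0 \<oplus>\<^bsub>A\<^esub> (\<Oplus>\<^bsub>A\<^esub>i\<in>{1..n}. v $ i \<odot>\<^bsub>A\<^esub> a i)"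
    unfolding A.lin_comb_def by (simp add: Pi_def)
  also have "(\<Oplus>\<^bsub>A\<^esub>i\<in>{1..n}. v $ i \<odot>\<^bsub>A\<^esub> a i) = (\<Oplus>\<^bsub>A\<^esub>i\<in>{1..n}. v $ i \<odot>\<^bsub>A\<^esub> clifford_type_gen n \<alpha> \<beta> \<gamma> lam (Gen_X i))"
  proof (rule A.finsum_cong')
    have "clifford_type_gen n \<alpha> \<beta> \<gamma> lam (Gen_X i) \<in> carrier A" if "i \<in> {1..n}" for i
      using that clifford_type_gen_closed[of i] by (simp add: nth_gen_def)
    then show "(\<lambda>i. v $ i \<odot>\<^bsub>A\<^esub> clifford_type_gen n \<alpha> \<beta> \<gamma> lam (Gen_X i)) \<in> {1..n} \<rightarrow> carrier A" by auto
  qed (auto simp: nth_gen_def)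
  finally show ?thesis by (simp add: clifford_type_lin_def Let_def nth_gen_def)
qed

lemma clifford_map_clifford_type_lin: "clifford_map V (quad_form M) A \<iota>"
  using A.clifford_map_lin_comb[OF two clifford_family_gens cl_matrix_carrier]
  by (simp add: clifford_type_lin_eq[abs_def])

lemma clifford_type_lin_unit:
  assumes "i \<le> n"
  shows "\<iota> (unit_vec (n + 1) i) = a i"
proof -
  have "\<iota> (unit_vec (n + 1) i) = (\<Oplus>\<^bsub>A\<^esub>j\<in>{0..n}. if i = j then a j else \<zero>\<^bsub>A\<^esub>)"
    unfolding clifford_type_lin_eq A.lin_comb_def
    by (rule A.finsum_cong') (use assms clifford_type_gen_closed in auto)
  also have "\<dots> = a i"
    by (rule A.finsum_singleton) (use assms clifford_type_gen_closed in auto)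
  finally show ?thesis .
qed

text \<open>
  The Clifford map \<open>\<phi>\<close> turns the unit vectors into a family that satisfies the defining relations.
  The homomorphism which this family induces agrees with \<open>\<phi>\<close> on unit vectors, hence everywhere.
\<close>

lemma clifford_type_universal:
  fixes B :: "('k, 'b) module"
  assumes B: "k_algebra B" and \<phi>: "clifford_map V (quad_form M) B \<phi>"
  shows "\<exists>h\<in>alg_hom A B. \<forall>v\<in>carrier V. h (\<iota> v) = \<phi> v"
proof -
  interpret B: k_algebra B by fact
  note \<phi>V = B.clifford_family_cliff_map[OF \<phi> cl_matrix_carrier cl_matrix_symmetric]
  obtain h where h: "h \<in> alg_hom A B" and ha: "\<forall>i\<le>n. h (a i) = \<phi> (unit_vec (n + 1) i)"
    using clifford_type_universal_family[OF B \<phi>V] by blast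
  have "h (\<iota> v) = \<phi> v" if v: "v \<in> carrier V" for v
  proof -
    have "h (\<iota> v) = (\<Oplus>\<^bsub>B\<^esub>i\<in>{0..n}. h (v $ i \<odot>\<^bsub>A\<^esub> a i))"
      unfolding clifford_type_lin_eq A.lin_comb_def
      by (rule alg_hom_finsum[OF A.k_algebra_axioms B h]) (auto simp: clifford_type_gen_closed)
    also have "\<dots> = B.lin_comb n (\<lambda>i. \<phi> (unit_vec (n + 1) i)) v"
      unfolding B.lin_comb_def
      by (rule B.finsum_cong')
         (use clifford_mapD(1)[OF \<phi>] ha in \<open>auto simp: alg_hom_smult[OF h] clifford_type_gen_closed module_vec_simps\<close>)
    also have "\<dots> = \<phi> v"
      by (rule B.clifford_map_eq_lin_comb[OF \<phi>, symmetric]) (use v in \<open>simp add: module_vec_simps\<close>)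
    finally show ?thesis .
  qed
  with h show ?thesis by blast
qed

lemma clifford_type_hom_eqI:
  fixes B :: "('k, 'b) module"
  assumes B: "k_algebra B" and f: "f \<in> alg_hom A B" and g: "g \<in> alg_hom A B"
    and eq: "\<And>v. v \<in> carrier V \<Longrightarrow> f (\<iota> v) = g (\<iota> v)"
    and x: "x \<in> carrier A"
  shows "f x = g x"
proof -
  have "f (a i) = g (a i)" if "i \<le> n" for i
    using eq[of "unit_vec (n + 1) i"] clifford_type_lin_unit[OF that]
    by (simp only: module_vec_simps unit_vec_carrier)
  then have "f (clifford_type_gen n \<alpha> \<beta> \<gamma> lam s) = g (clifford_type_gen n \<alpha> \<beta> \<gamma> lam s)" if "s \<in> cl_gens n" for s
    using that by (auto simp: cl_gens_eq)
  from f g this x show ?thesis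
    unfolding clifford_type_alg_def clifford_type_gen_def
    by (rule presented_alg_hom_eqI[OF cl_rels_carrier B])
qed

end

section \<open>Isomorphisms from the universal properties\<close>

lemma alg_hom_id: "(\<lambda>x. x) \<in> alg_hom A A"
  by (rule alg_homI) auto

context clifford_type
begin

text \<open>
  Both algebras are universal for Clifford maps on \<open>(V, q)\<close>, so the two comparison homomorphisms are
  inverse to each other.
\<close>

lemma clifford_alg_iso: "alg_iso (clifford_alg V (quad_form M)) A \<noteq> {}"
proof -
  let ?C = "clifford_alg V (quad_form M)" and ?e = "clifford_embed V (quad_form M)"
  have V: "u \<in> carrier V \<Longrightarrow> v \<in> carrier V \<Longrightarrow> u \<oplus>\<^bsub>V\<^esub> v \<in> carrier V"
    "v \<in> carrier V \<Longrightarrow> c \<odot>\<^bsub>V\<^esub> v \<in> carrier V" for u v c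
    by (simp_all add: module_vec_simps)
  have C: "k_algebra ?C" by (rule k_algebra_clifford_alg[OF V])
  obtain f where f: "f \<in> alg_hom ?C A" "\<forall>v\<in>carrier V. f (?e v) = \<iota> v"
    using clifford_alg_universal[OF V k_algebra_clifford_type clifford_map_clifford_type_lin] by blast
  obtain g where g: "g \<in> alg_hom A ?C" "\<forall>v\<in>carrier V. g (\<iota> v) = ?e v"
    using clifford_type_universal[OF C clifford_map_clifford_embed[OF V]] by blast
  have "g (f x) = x" if "x \<in> carrier ?C" for x
    using clifford_alg_hom_eqI[OF V C alg_hom_comp[OF f(1) g(1)] alg_hom_id _ that] f(2) g(2) by simp
  moreover have "f (g x) = x" if "x \<in> carrier A" for x
    using clifford_type_hom_eqI[OF k_algebra_clifford_type alg_hom_comp[OF g(1) f(1)] alg_hom_id _ that]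
      f(2) g(2) by simp
  ultimately have "f \<in> alg_iso ?C A" by (rule alg_isoI[OF f(1) g(1)])
  then show ?thesis by blast
qed

end

lemma clifford_map_comp_mat:
  fixes P :: "'k::field mat"
  assumes \<phi>: "clifford_map (module_vec TYPE('k) m) q B \<phi>" and P: "P \<in> carrier_mat m m"
    and q: "\<And>v. v \<in> carrier_vec m \<Longrightarrow> q (P *\<^sub>v v) = q' v"
  shows "clifford_map (module_vec TYPE('k) m) q' B (\<lambda>v. \<phi> (P *\<^sub>v v))"
proof -
  have c: "P *\<^sub>v v \<in> carrier_vec m" if "v \<in> carrier_vec m" for v using P that by simp
  note D = clifford_mapD[OF \<phi>, unfolded module_vec_simps]
  show ?thesis
    unfolding clifford_map_def module_vec_simps
    using P by (simp add: D c q mult_add_distrib_mat_vec mult_mat_vec)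
qed

text \<open>
  An isometry \<open>P\<close> and its inverse \<open>C\<close> turn the canonical Clifford map of either algebra into a
  Clifford map for the other form.
\<close>

lemma change_of_basis:
  fixes P :: "'k::field mat"
  assumes two: "(2::'k) \<noteq> 0"
    and P: "P \<in> carrier_mat (n + 1) (n + 1)" and C: "C \<in> carrier_mat (n + 1) (n + 1)"
    and PC: "P * C = 1\<^sub>m (n + 1)" and CP: "C * P = 1\<^sub>m (n + 1)"
    and q: "\<And>v. v \<in> carrier_vec (n + 1) \<Longrightarrow>
      cl_form n \<alpha> \<beta> \<gamma> lam (P *\<^sub>v v) = cl_form n \<alpha>' \<beta>' \<gamma>' lam' v"
  shows "\<exists>\<phi>\<in>alg_iso (clifford_type_alg n \<alpha>' \<beta>' \<gamma>' lam') (clifford_type_alg n \<alpha> \<beta> \<gamma> lam).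
    \<forall>v\<in>carrier_vec (n + 1). \<phi> (clifford_type_lin n \<alpha>' \<beta>' \<gamma>' lam' v) = clifford_type_lin n \<alpha> \<beta> \<gamma> lam (P *\<^sub>v v)"
proof -
  interpret A: clifford_type n \<alpha> \<beta> \<gamma> lam by unfold_locales (rule two)
  interpret D: clifford_type n \<alpha>' \<beta>' \<gamma>' lam' by unfold_locales (rule two)
  have PCv: "P *\<^sub>v (C *\<^sub>v v) = v" and CPv: "C *\<^sub>v (P *\<^sub>v v) = v"
    if "v \<in> carrier_vec (n + 1)" for v
    using assoc_mult_mat_vec[OF P C that] assoc_mult_mat_vec[OF C P that] PC CP that by simp_all
  have q1: "quad_form A.M (P *\<^sub>v v) = quad_form D.M v" if "v \<in> carrier_vec (n + 1)" for v
    using q[OF that] by (simp add: cl_form_eq)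
  have q2: "quad_form D.M (C *\<^sub>v v) = quad_form A.M v" if "v \<in> carrier_vec (n + 1)" for v
    using q1[of "C *\<^sub>v v"] C that PCv by simp
  obtain f where f: "f \<in> alg_hom D.A A.A" "\<forall>v\<in>carrier A.V. f (D.\<iota> v) = A.\<iota> (P *\<^sub>v v)"
    using D.clifford_type_universal[OF A.k_algebra_clifford_type
      clifford_map_comp_mat[OF A.clifford_map_clifford_type_lin P q1]] by blast
  obtain g where g: "g \<in> alg_hom A.A D.A" "\<forall>v\<in>carrier A.V. g (A.\<iota> v) = D.\<iota> (C *\<^sub>v v)"
    using A.clifford_type_universal[OF D.k_algebra_clifford_type
      clifford_map_comp_mat[OF D.clifford_map_clifford_type_lin C q2]] by blast
  have gf: "g (f (D.\<iota> v)) = D.\<iota> v" and fg: "f (g (A.\<iota> v)) = A.\<iota> v" if "v \<in> carrier A.V" for v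
    using that f(2) g(2) P C PCv CPv by (simp_all only: module_vec_simps mult_mat_vec_carrier)
  have "g (f x) = x" if "x \<in> carrier D.A" for x
    using D.clifford_type_hom_eqI[OF D.k_algebra_clifford_type alg_hom_comp[OF f(1) g(1)] alg_hom_id _ that]
      gf by simp
  moreover have "f (g x) = x" if "x \<in> carrier A.A" for x
    using A.clifford_type_hom_eqI[OF A.k_algebra_clifford_type alg_hom_comp[OF g(1) f(1)] alg_hom_id _ that]
      fg by simp
  ultimately have "f \<in> alg_iso D.A A.A" by (rule alg_isoI[OF f(1) g(1)])
  with f(2) show ?thesis by (auto simp: module_vec_simps)
qed

section \<open>Orthogonal families over a symmetric matrix\<close>

text \<open>
  The family is a basis if and only if this matrix has nonzero determinant, which is easier to track
  through elimination than spans are.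
\<close>

definition cols_mat :: "nat \<Rightarrow> (nat \<Rightarrow> 'k vec) \<Rightarrow> 'k mat" where
  "cols_mat m b = mat m m (\<lambda>(i, j). b j $ i)"

lemma cols_mat_carrier [simp]: "cols_mat m b \<in> carrier_mat m m"
  by (simp add: cols_mat_def)

lemma cols_cols_mat:
  assumes "\<And>i. i < m \<Longrightarrow> b i \<in> carrier_vec m"
  shows "cols (cols_mat m b) = map b [0..<m]"
proof (rule nth_equalityI)
  fix i assume "i < length (cols (cols_mat m b))"
  then have i: "i < m" by (simp add: cols_mat_def)
  have "col (cols_mat m b) i = b i"
    using i assms[OF i] by (intro eq_vecI) (auto simp: cols_mat_def)
  then show "cols (cols_mat m b) ! i = map b [0..<m] ! i" using i by (simp add: cols_mat_def)
qed (simp add: cols_mat_def)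

lemma basis_iff_det:
  fixes b :: "nat \<Rightarrow> 'k::field vec"
  assumes b: "\<And>i. i < m \<Longrightarrow> b i \<in> carrier_vec m"
  shows "inj_on b {..<m} \<and> vectorspace.basis class_ring (module_vec TYPE('k) m) (b ` {..<m})
    \<longleftrightarrow> det (cols_mat m b) \<noteq> 0"
proof -
  interpret V: vec_space "TYPE('k)" m .
  let ?P = "cols_mat m b"
  have set: "set (cols ?P) = b ` {..<m}"
    using cols_cols_mat[of m b] b by (simp add: atLeast0LessThan)
  have dist: "distinct (cols ?P) \<longleftrightarrow> inj_on b {..<m}"
    using cols_cols_mat[of m b] b by (simp add: distinct_map atLeast0LessThan)
  show ?thesis
  proof
    assume "inj_on b {..<m} \<and> V.basis (b ` {..<m})"
    then show "det ?P \<noteq> 0"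
      using V.lin_indpt_full_rank[of ?P m] dist set V.det_rank_iff[of ?P] by (auto simp: V.basis_def)
  next
    assume "det ?P \<noteq> 0"
    then have rank: "V.rank ?P = m" by (simp add: V.det_rank_iff)
    then have d: "distinct (cols ?P)" using V.non_distinct_low_rank[of ?P] by auto
    have li: "V.lin_indpt (b ` {..<m})"
      using V.full_rank_lin_indpt[of ?P m] rank d set by simp
    have "V.basis (b ` {..<m})"
    proof (rule V.dim_li_is_basis[OF V.fin_dim _ _ li])
      show "card (b ` {..<m}) \<ge> V.dim"
        using d dist by (simp add: card_image V.dim_is_n)
    qed (use b in auto)
    with d dist show "inj_on b {..<m} \<and> V.basis (b ` {..<m})" by simp
  qed
qed

lemma det_nonzero_iff_inj:
  fixes P :: "'k::field mat"
  assumes "P \<in> carrier_mat m m"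
  shows "det P \<noteq> 0 \<longleftrightarrow> (\<forall>v\<in>carrier_vec m. P *\<^sub>v v = 0\<^sub>v m \<longrightarrow> v = 0\<^sub>v m)"
  using det_0_iff_vec_prod_zero_field[OF assms] by auto

text \<open>
  A shear, which adds multiples of the member \<open>b\<^sub>k\<close> to the other ones, is invertible.  In terms of
  kernels: a linear relation \<open>v\<close> between the new vectors yields the relation \<open>w = v + s e\<^sub>k\<close> between
  the old ones, which is trivial, and then \<open>v\<close> vanishes away from \<open>k\<close>, so that \<open>s = 0\<close>.
\<close>

lemma det_shear_nonzero:
  fixes b :: "nat \<Rightarrow> 'k::field vec"
  assumes b: "\<And>i. i < m \<Longrightarrow> b i \<in> carrier_vec m" and k: "k < m" and c: "c k = 0"
    and det: "det (cols_mat m b) \<noteq> 0"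
  shows "det (cols_mat m (\<lambda>i. b i + c i \<cdot>\<^sub>v b k)) \<noteq> 0"
  unfolding det_nonzero_iff_inj[OF cols_mat_carrier]
proof (intro ballI impI)
  let ?b = "\<lambda>i. b i + c i \<cdot>\<^sub>v b k"
  fix v :: "'k vec" assume v: "v \<in> carrier_vec m" and "cols_mat m ?b *\<^sub>v v = 0\<^sub>v m"
  define s where "s = (\<Sum>j<m. c j * v $ j)"
  define w where "w = v + s \<cdot>\<^sub>v unit_vec m k"
  have w: "w \<in> carrier_vec m" using v by (simp add: w_def)
  have wi: "w $ i = v $ i + (if i = k then s else 0)" if "i < m" for i
    using that v k by (simp add: w_def)
  have "cols_mat m b *\<^sub>v w = cols_mat m ?b *\<^sub>v v"
  proof (rule eq_vecI)
    fix i assume "i < dim_vec (cols_mat m ?b *\<^sub>v v)"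
    then have i: "i < m" by (simp add: cols_mat_def)
    have "(cols_mat m b *\<^sub>v w) $ i = (\<Sum>j<m. b j $ i * w $ j)"
      using i w by (simp add: cols_mat_def scalar_prod_def atLeast0LessThan)
    also have "\<dots> = (\<Sum>j<m. b j $ i * v $ j) + (\<Sum>j<m. if j = k then b j $ i * s else 0)"
      unfolding sum.distrib[symmetric] by (rule sum.cong) (auto simp: wi algebra_simps)
    also have "(\<Sum>j<m. if j = k then b j $ i * s else 0) = (\<Sum>j<m. c j * b k $ i * v $ j)"
      using k by (simp add: s_def sum_distrib_left mult_ac)
    also have "(\<Sum>j<m. b j $ i * v $ j) + (\<Sum>j<m. c j * b k $ i * v $ j) = (\<Sum>j<m. ?b j $ i * v $ j)"
      unfolding sum.distrib[symmetric]
    proof (rule sum.cong)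
      fix j assume "j \<in> {..<m}"
      then show "b j $ i * v $ j + c j * b k $ i * v $ j = ?b j $ i * v $ j"
        using b[of j] b[OF k] i by (auto simp: algebra_simps)
    qed simp
    also have "\<dots> = (cols_mat m ?b *\<^sub>v v) $ i"
      using i v by (simp add: cols_mat_def scalar_prod_def atLeast0LessThan)
    finally show "(cols_mat m b *\<^sub>v w) $ i = (cols_mat m ?b *\<^sub>v v) $ i" .
  qed (simp add: cols_mat_def)
  with \<open>cols_mat m ?b *\<^sub>v v = 0\<^sub>v m\<close> have "w = 0\<^sub>v m"
    using det w unfolding det_nonzero_iff_inj[OF cols_mat_carrier] by simp
  then have w0: "v $ i + (if i = k then s else 0) = 0" if "i < m" for i
    using wi[OF that] that by simp
  have "s = 0"
    unfolding s_def
  proof (rule sum.neutral, rule ballI)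
    fix j assume "j \<in> {..<m}"
    then show "c j * v $ j = 0" using w0[of j] c by (cases "j = k") auto
  qed
  then show "v = 0\<^sub>v m" using w0 v by (intro eq_vecI) (auto split: if_splits)
qed

text \<open>
  Symmetric elimination.  The invariant is a set \<open>I\<close> of indices whose vectors are orthogonal to all
  other members of the family.  A nonisotropic vector \<open>b\<^sub>k\<close> outside \<open>I\<close> is split off by a shear.  If
  there is none, but \<open>B(b\<^sub>k, b\<^sub>l) \<noteq> 0\<close> for two indices outside \<open>I\<close>, then \<open>b\<^sub>k + b\<^sub>l\<close> has the value
  \<open>2 B(b\<^sub>k, b\<^sub>l) \<noteq> 0\<close> and becomes the pivot.  If there is no such pair either, the family is orthogonal.
  Tracking a set instead of an initial segment makes swaps unnecessary.
\<close>

lemma exists_orthogonal_family: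
  fixes M :: "'k::field mat"
  assumes two: "(2::'k) \<noteq> 0" and M: "M \<in> carrier_mat m m" "transpose_mat M = M"
  shows "\<exists>b. (\<forall>i<m. b i \<in> carrier_vec m) \<and> det (cols_mat m b) \<noteq> 0 \<and>
    (\<forall>i<m. \<forall>j<m. i \<noteq> j \<longrightarrow> b i \<bullet> (M *\<^sub>v b j) = 0)"
proof -
  define B where "B u v = u \<bullet> (M *\<^sub>v v)" for u v
  have B_sym: "B u v = B v u" if u: "u \<in> carrier_vec m" and v: "v \<in> carrier_vec m" for u v
  proof -
    have Mu: "M *\<^sub>v u \<in> carrier_vec m" using M(1) u by simp
    have "B u v = (M *\<^sub>v u) \<bullet> v"
      using transpose_vec_mult_scalar[OF M(1) v u] M(2) by (simp add: B_def)
    also have "\<dots> = B v u" unfolding B_def by (rule comm_scalar_prod[OF Mu v])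
    finally show ?thesis .
  qed
  have B_r: "B u (v + c \<cdot>\<^sub>v w) = B u v + c * B u w"
    if u: "u \<in> carrier_vec m" and v: "v \<in> carrier_vec m" and w: "w \<in> carrier_vec m" for u v w c
  proof -
    have "M *\<^sub>v (v + c \<cdot>\<^sub>v w) = M *\<^sub>v v + c \<cdot>\<^sub>v (M *\<^sub>v w)"
      using mult_add_distrib_mat_vec[OF M(1) v, of "c \<cdot>\<^sub>v w"] mult_mat_vec[OF M(1) w] w by simp
    moreover have "M *\<^sub>v v \<in> carrier_vec m" "M *\<^sub>v w \<in> carrier_vec m" using M(1) v w by simp_all
    ultimately show ?thesis
      using scalar_prod_add_distrib[OF u, of "M *\<^sub>v v" "c \<cdot>\<^sub>v (M *\<^sub>v w)"]
        scalar_prod_smult_distrib[OF u, of "M *\<^sub>v w" c]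
      by (simp add: B_def)
  qed
  have B_l: "B (u + c \<cdot>\<^sub>v w) v = B u v + c * B w v"
    if u: "u \<in> carrier_vec m" and v: "v \<in> carrier_vec m" and w: "w \<in> carrier_vec m" for u v w c
    using B_r[OF v u w] B_sym[OF v, of "u + c \<cdot>\<^sub>v w"] B_sym[OF v u] B_sym[OF v w] u w by simp
  define frame where
    "frame b \<longleftrightarrow> (\<forall>i<m. b i \<in> carrier_vec m) \<and> det (cols_mat m b) \<noteq> 0" for b :: "nat \<Rightarrow> 'k vec"
  define split where
    "split I b \<longleftrightarrow> (\<forall>i\<in>I. \<forall>j<m. i \<noteq> j \<longrightarrow> B (b i) (b j) = 0)" for I :: "nat set" and b
  have frame_shear: "frame (\<lambda>i. b i + c i \<cdot>\<^sub>v b k)" if "frame b" "k < m" "c k = 0" for b c k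
    using that det_shear_nonzero[of m b k c] by (simp add: frame_def)
  have B_shear: "B (b i + c i \<cdot>\<^sub>v b k) (b j + c j \<cdot>\<^sub>v b k)
      = B (b i) (b j) + c j * B (b i) (b k) + c i * B (b k) (b j) + c i * c j * B (b k) (b k)"
    if "frame b" "i < m" "j < m" "k < m" for b c i j k
    using that by (simp add: frame_def B_r B_l algebra_simps)
  have pivot: "\<exists>b'. frame b' \<and> split (insert k I) b'"
    if fr: "frame b" and sp: "split I b" and I: "I \<subseteq> {..<m}" and k: "k < m" and nz: "B (b k) (b k) \<noteq> 0"
    for b k I
  proof -
    \<comment> \<open>Gram--Schmidt coefficients for the pivot; they vanish on \<open>I\<close>, whose vectors are not moved.\<close>
    define c where "c i = (if i = k then 0 else - B (b i) (b k) / B (b k) (b k))" for i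
    let ?b = "\<lambda>i. b i + c i \<cdot>\<^sub>v b k"
    have sym: "B (b i) (b j) = B (b j) (b i)" if "i < m" "j < m" for i j
      using fr that B_sym by (simp add: frame_def)
    have "split (insert k I) ?b"
      unfolding split_def
    proof (intro ballI allI impI)
      fix i j assume "i \<in> insert k I" and j: "j < m" and ij: "i \<noteq> j"
      then have i: "i < m" using I k by auto
      show "B (?b i) (?b j) = 0"
      proof (cases "i = k")
        case True
        then show ?thesis
          unfolding B_shear[OF fr i j k] using ij nz sym[OF k j] by (simp add: c_def)
      next
        case False
        then have iI: "i \<in> I" using \<open>i \<in> insert k I\<close> by simp
        then have "B (b i) (b j) = 0" "B (b i) (b k) = 0"
          using sp j k ij False by (auto simp: split_def)
        then show ?thesis unfolding B_shear[OF fr i j k] using False by (simp add: c_def)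
      qed
    qed
    with frame_shear[OF fr k, of c] show ?thesis by (auto simp: c_def)
  qed
  have "\<exists>b'. frame b' \<and> split {..<m} b'"
    if "frame b" "split I b" "I \<subseteq> {..<m}" for b I
    using that
  proof (induction "card ({..<m} - I)" arbitrary: b I rule: less_induct)
    case less
    note fr = less.prems(1) and sp = less.prems(2) and I = less.prems(3)
    have step: "\<exists>b'. frame b' \<and> split {..<m} b'"
      if fr': "frame b'" and sp': "split I b'" and k: "k < m" "k \<notin> I" and nz: "B (b' k) (b' k) \<noteq> 0" for b' k
    proof -
      obtain b'' where b'': "frame b''" "split (insert k I) b''"
        using pivot[OF fr' sp' I k(1) nz] by blast
      have "card ({..<m} - insert k I) < card ({..<m} - I)"
        using k by (intro psubset_card_mono) auto
      from less.hyps[OF this b''] I k show ?thesis by simp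
    qed
    show ?case
    proof (cases "\<exists>k<m. k \<notin> I \<and> B (b k) (b k) \<noteq> 0")
      case True
      then show ?thesis using step[OF fr sp] by blast
    next
      case isotropic: False
      show ?thesis
      proof (cases "\<exists>k<m. \<exists>l<m. k \<notin> I \<and> l \<notin> I \<and> k \<noteq> l \<and> B (b k) (b l) \<noteq> 0")
        case True
        then obtain k l where kl: "k < m" "l < m" "k \<notin> I" "l \<notin> I" "k \<noteq> l" "B (b k) (b l) \<noteq> 0" by blast
        define c where "c i = (if i = k then 1 else 0 :: 'k)" for i
        let ?b = "\<lambda>i. b i + c i \<cdot>\<^sub>v b l"
        have fr': "frame ?b" using kl by (intro frame_shear[OF fr]) (simp_all add: c_def)
        have "B (b l) (b k) = B (b k) (b l)" using fr kl B_sym by (simp add: frame_def)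
        moreover have "B (b k) (b k) = 0" "B (b l) (b l) = 0" using isotropic kl by blast+
        ultimately have "B (?b k) (?b k) = 2 * B (b k) (b l)"
          unfolding B_shear[OF fr kl(1) kl(1) kl(2)] by (simp add: c_def)
        then have nz: "B (?b k) (?b k) \<noteq> 0" using kl two by simp
        have sp': "split I ?b"
          unfolding split_def
        proof (intro ballI allI impI)
          fix i j assume i: "i \<in> I" and j: "j < m" and ij: "i \<noteq> j"
          then have "i < m" "c i = 0" "B (b i) (b j) = 0" "B (b i) (b l) = 0"
            using I kl sp by (auto simp: c_def split_def)
          then show "B (?b i) (?b j) = 0" unfolding B_shear[OF fr \<open>i < m\<close> j kl(2)] by simp
        qed
        show ?thesis by (rule step[OF fr' sp' kl(1) kl(3) nz])
      next
        case False
        have "split {..<m} b"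
          unfolding split_def
        proof (intro ballI allI impI)
          fix i j assume i: "i \<in> {..<m}" and j: "j < m" and ij: "i \<noteq> j"
          have "B (b i) (b j) = B (b j) (b i)" using fr i j B_sym by (simp add: frame_def)
          then show "B (b i) (b j) = 0"
            using False sp i j ij unfolding split_def by (metis lessThan_iff)
        qed
        with fr show ?thesis by blast
      qed
    qed
  qed
  moreover have "frame (unit_vec m)"
  proof -
    have "cols_mat m (unit_vec m) = (1\<^sub>m m :: 'k mat)"
      by (rule eq_matI) (auto simp: cols_mat_def)
    then show ?thesis by (simp add: frame_def)
  qed
  moreover have "split {} (unit_vec m)" by (simp add: split_def)
  ultimately obtain b where "frame b" "split {..<m} b" by blast
  then show ?thesis by (intro exI[of _ b]) (auto simp: frame_def split_def B_def)
qed

section \<open>A representation of diagonal Clifford-type algebras\<close>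

definition linear_endomorphisms :: "('k::field, ('s \<Rightarrow> 'k) \<Rightarrow> 's \<Rightarrow> 'k) module" where
  "linear_endomorphisms =
    \<lparr>carrier = {F. (\<forall>f g. F (\<lambda>s. f s + g s) = (\<lambda>s. F f s + F g s)) \<and>
                   (\<forall>c f. F (\<lambda>s. c * f s) = (\<lambda>s. c * F f s))},
     mult = (\<circ>), one = (\<lambda>f. f), zero = (\<lambda>_ _. 0), add = (\<lambda>F G f s. F f s + G f s),
     smult = (\<lambda>c F f s. c * F f s)\<rparr>"

lemma k_algebra_linear_endomorphisms: "k_algebra (linear_endomorphisms :: ('k::field, ('s \<Rightarrow> 'k) \<Rightarrow> 's \<Rightarrow> 'k) module)"
proof -
  let ?E = "linear_endomorphisms :: ('k, ('s \<Rightarrow> 'k) \<Rightarrow> 's \<Rightarrow> 'k) module"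
  have "ring ?E"
  proof (rule ringI)
    show "abelian_group ?E"
    proof (rule abelian_groupI)
      fix F assume "F \<in> carrier ?E"
      then show "\<exists>G\<in>carrier ?E. G \<oplus>\<^bsub>?E\<^esub> F = \<zero>\<^bsub>?E\<^esub>"
        by (intro bexI[of _ "\<lambda>f s. - F f s"]) (auto simp: linear_endomorphisms_def)
    qed (auto simp: linear_endomorphisms_def algebra_simps)
    show "Group.monoid ?E"
      by (rule monoidI) (auto simp: linear_endomorphisms_def o_def)
  qed (auto simp: linear_endomorphisms_def o_def)
  then show ?thesis
    by (intro k_algebra.intro k_algebra_axioms.intro)
       (auto simp: linear_endomorphisms_def o_def algebra_simps)
qed

lemma finsum_linear_endomorphisms:
  assumes "finite I" "\<And>i. i \<in> I \<Longrightarrow> F i \<in> carrier (linear_endomorphisms :: ('k::field, ('s \<Rightarrow> 'k) \<Rightarrow> 's \<Rightarrow> 'k) module)"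
  shows "(\<Oplus>\<^bsub>linear_endomorphisms\<^esub>i\<in>I. F i) f s = (\<Sum>i\<in>I. F i f s)"
proof -
  interpret E: k_algebra "linear_endomorphisms :: ('k, ('s \<Rightarrow> 'k) \<Rightarrow> 's \<Rightarrow> 'k) module" by (rule k_algebra_linear_endomorphisms)
  from assms show ?thesis
  proof (induction I rule: finite_induct)
    case empty
    show ?case unfolding E.finsum_empty by (simp add: linear_endomorphisms_def)
  next
    case (insert i I)
    then have "(\<Oplus>\<^bsub>linear_endomorphisms\<^esub>i\<in>insert i I. F i) = F i \<oplus>\<^bsub>linear_endomorphisms\<^esub> (\<Oplus>\<^bsub>linear_endomorphisms\<^esub>i\<in>I. F i)"
      by (intro E.finsum_insert) auto
    with insert show ?case by (simp add: linear_endomorphisms_def)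
  qed
qed

definition toggle :: "nat \<Rightarrow> nat set \<Rightarrow> nat set" where
  "toggle i P = (if i \<in> P then P - {i} else insert i P)"

text \<open>
  The sign which a generator picks up when it moves past the smaller elements of \<open>P\<close> to its place in
  an ordered product.  The set of smaller elements is finite even if \<open>P\<close> is not.
\<close>

definition position_sign :: "nat \<Rightarrow> nat set \<Rightarrow> 'k::field" where
  "position_sign i P = (- 1) ^ card {k \<in> P. k < i}"

text \<open>
  The action of the \<open>i\<close>-th generator on coefficient functions of formal sums of ordered products of
  generators: \<open>y\<^sub>i\<close> either inserts the factor \<open>i\<close>, or removes it and contributes \<open>y\<^sub>i\<^sup>2 = d\<^sub>i\<close>.
  The coefficient at \<open>P\<close> of the result comes from \<open>P\<close> with \<open>i\<close> toggled, which explains why \<open>d\<^sub>i\<close>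
  appears in the case \<open>i \<notin> P\<close>.
\<close>

definition clifford_op :: "(nat \<Rightarrow> 'k::field) \<Rightarrow> nat \<Rightarrow> (nat set \<Rightarrow> 'k) \<Rightarrow> nat set \<Rightarrow> 'k" where
  "clifford_op d i f P = position_sign i P * (if i \<in> P then 1 else d i) * f (toggle i P)"

lemma toggle_toggle: "toggle i (toggle i P) = P"
  by (auto simp: toggle_def)

lemma toggle_commute: "toggle i (toggle j P) = toggle j (toggle i P)"
  by (auto simp: toggle_def)

lemma mem_toggle: "i \<in> toggle j P \<longleftrightarrow> (if i = j then i \<notin> P else i \<in> P)"
  by (auto simp: toggle_def)

lemma position_sign_toggle_ge: "i \<le> j \<Longrightarrow> position_sign i (toggle j P) = position_sign i P"
proof -
  assume "i \<le> j"
  then have "{k \<in> toggle j P. k < i} = {k \<in> P. k < i}" by (auto simp: toggle_def)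
  then show ?thesis by (simp add: position_sign_def)
qed

lemma position_sign_toggle_less:
  assumes "i < j"
  shows "position_sign j (toggle i P) = - position_sign j P"
proof (cases "i \<in> P")
  case True
  let ?S = "{k \<in> P. k < j}"
  have "{k \<in> toggle i P. k < j} = ?S - {i}" using True by (auto simp: toggle_def)
  moreover have "card ?S = Suc (card (?S - {i}))"
    using assms True by (intro card.remove) auto
  ultimately show ?thesis by (simp add: position_sign_def)
next
  case False
  let ?S = "{k \<in> P. k < j}"
  have "{k \<in> toggle i P. k < j} = insert i ?S" using False assms by (auto simp: toggle_def)
  moreover have "card (insert i ?S) = Suc (card ?S)" using False by simp
  ultimately show ?thesis by (simp add: position_sign_def)
qed

lemma clifford_op_square: "clifford_op d i (clifford_op d i f) P = d i * f P"
proof -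
  have "position_sign i P * position_sign i P = (1 :: 'a)"
    by (simp add: position_sign_def flip: power_add mult_2)
  moreover have "clifford_op d i (clifford_op d i f) P
      = (position_sign i P * position_sign i P) * (d i * f P)"
    by (simp add: clifford_op_def toggle_toggle mem_toggle position_sign_toggle_ge)
  ultimately show ?thesis by simp
qed

text \<open>
  Toggling \<open>i\<close> shifts the position of a larger \<open>j\<close> by one, while toggling \<open>j\<close> leaves the position of \<open>i\<close>
  alone.  So the two products have opposite signs, and their other factors agree.
\<close>

lemma clifford_op_anticommute:
  "i < j \<Longrightarrow> clifford_op d i (clifford_op d j f) P + clifford_op d j (clifford_op d i f) P = 0"
  by (simp add: clifford_op_def mem_toggle position_sign_toggle_ge position_sign_toggle_less
      toggle_commute[of j i])

lemma clifford_op_closed: "clifford_op d i \<in> carrier linear_endomorphisms"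
  by (auto simp: linear_endomorphisms_def clifford_op_def algebra_simps)

locale diagonal_clifford_type = clifford_type n "d 0" d "\<lambda>_. 0" "\<lambda>_ _. 0"
  for n and d :: "nat \<Rightarrow> 'k::field"
begin

lemma clifford_family_clifford_op: "clifford_family n M linear_endomorphisms (clifford_op d)"
proof -
  have "clifford_op d i \<otimes>\<^bsub>linear_endomorphisms\<^esub> clifford_op d i = d i \<odot>\<^bsub>linear_endomorphisms\<^esub> \<one>\<^bsub>linear_endomorphisms\<^esub>" for i
    by (simp add: linear_endomorphisms_def o_def clifford_op_square[abs_def])
  moreover have "clifford_op d i \<otimes>\<^bsub>linear_endomorphisms\<^esub> clifford_op d j \<oplus>\<^bsub>linear_endomorphisms\<^esub> clifford_op d j \<otimes>\<^bsub>linear_endomorphisms\<^esub> clifford_op d i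
      = 0 \<odot>\<^bsub>linear_endomorphisms\<^esub> \<one>\<^bsub>linear_endomorphisms\<^esub>" if "i < j" for i j
    by (simp add: linear_endomorphisms_def clifford_op_anticommute[OF that])
  ultimately show ?thesis
    by (subst clifford_family_iff_relations[OF k_algebra_linear_endomorphisms]) (auto simp: clifford_op_closed)
qed

text \<open>
  The empty product, here the indicator function of the empty set, is mapped by \<open>\<iota> v\<close> to a function
  whose values at the singletons are the coordinates of \<open>v\<close>.
\<close>

lemma representation:
  "\<exists>h\<in>alg_hom A linear_endomorphisms. \<forall>v. \<forall>j\<le>n. h (\<iota> v) (\<lambda>P. if P = {} then 1 else 0) {j} = v $ j"
proof -
  interpret A: k_algebra A by (rule k_algebra_clifford_type)
  interpret E: k_algebra "linear_endomorphisms :: ('k, (nat set \<Rightarrow> 'k) \<Rightarrow> nat set \<Rightarrow> 'k) module"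
    by (rule k_algebra_linear_endomorphisms)
  obtain h where h: "h \<in> alg_hom A linear_endomorphisms" and ha: "\<forall>i\<le>n. h (a i) = clifford_op d i"
    using clifford_type_universal_family[OF k_algebra_linear_endomorphisms clifford_family_clifford_op] by blast
  have "h (\<iota> v) (\<lambda>P. if P = {} then 1 else 0) {j} = v $ j" if j: "j \<le> n" for v j
  proof -
    let ?\<delta> = "\<lambda>P. if P = {} then 1 else (0::'k)"
    have "h (\<iota> v) = (\<Oplus>\<^bsub>linear_endomorphisms\<^esub>i\<in>{0..n}. h (v $ i \<odot>\<^bsub>A\<^esub> a i))"
      unfolding clifford_type_lin_eq A.lin_comb_def
      by (rule alg_hom_finsum[OF A.k_algebra_axioms E.k_algebra_axioms h]) (auto simp: clifford_type_gen_closed)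
    then have "h (\<iota> v) ?\<delta> {j} = (\<Sum>i\<in>{0..n}. h (v $ i \<odot>\<^bsub>A\<^esub> a i) ?\<delta> {j})"
      using finsum_linear_endomorphisms[of "{0..n}" "\<lambda>i. h (v $ i \<odot>\<^bsub>A\<^esub> a i)"] alg_hom_closed[OF h]
      by (simp add: clifford_type_gen_closed)
    also have "\<dots> = (\<Sum>i\<in>{0..n}. if i = j then v $ i else 0)"
    proof (rule sum.cong)
      fix i assume i: "i \<in> {0..n}"
      have "h (v $ i \<odot>\<^bsub>A\<^esub> a i) ?\<delta> {j} = v $ i * clifford_op d i ?\<delta> {j}"
        using i ha by (simp add: alg_hom_smult[OF h] clifford_type_gen_closed) (simp add: linear_endomorphisms_def)
      also have "clifford_op d i ?\<delta> {j} = (if i = j then 1 else 0)"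
      proof -
        have empty: "{k \<in> {j}. k < j} = {}" by auto
        have "position_sign j {j} = (1 :: 'k)" unfolding position_sign_def empty by simp
        then show ?thesis by (auto simp: clifford_op_def toggle_def)
      qed
      finally show "h (v $ i \<odot>\<^bsub>A\<^esub> a i) ?\<delta> {j} = (if i = j then v $ i else 0)" by simp
    qed simp
    also have "\<dots> = v $ j" using j by simp
    finally show ?thesis .
  qed
  with h show ?thesis by blast
qed

lemma diagonal_one_neq_zero: "\<one>\<^bsub>A\<^esub> \<noteq> \<zero>\<^bsub>A\<^esub>"
proof
  assume "\<one>\<^bsub>A\<^esub> = \<zero>\<^bsub>A\<^esub>"
  moreover obtain h :: "_ \<Rightarrow> (nat set \<Rightarrow> 'k) \<Rightarrow> nat set \<Rightarrow> 'k" where h: "h \<in> alg_hom A linear_endomorphisms"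
    using representation by blast
  ultimately have "\<one>\<^bsub>linear_endomorphisms\<^esub> = (\<zero>\<^bsub>linear_endomorphisms\<^esub> :: (nat set \<Rightarrow> 'k) \<Rightarrow> nat set \<Rightarrow> 'k)"
    using alg_hom_one[OF h] alg_hom_zero[OF k_algebra_clifford_type k_algebra_linear_endomorphisms h] by simp
  then have "\<one>\<^bsub>linear_endomorphisms\<^esub> (\<lambda>_ :: nat set. 1) {} = (\<zero>\<^bsub>linear_endomorphisms\<^esub> (\<lambda>_ :: nat set. 1) {} :: 'k)" by simp
  then show False by (simp add: linear_endomorphisms_def)
qed

lemma clifford_type_lin_inj:
  assumes v: "v \<in> carrier_vec (n + 1)" and 0: "\<iota> v = \<zero>\<^bsub>A\<^esub>"
  shows "v = 0\<^sub>v (n + 1)"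
proof -
  obtain h where h: "h \<in> alg_hom A linear_endomorphisms"
    and hv: "\<forall>v. \<forall>j\<le>n. h (\<iota> v) (\<lambda>P. if P = {} then 1 else 0) {j} = v $ j"
    using representation by blast
  have "h (\<iota> v) = \<zero>\<^bsub>linear_endomorphisms\<^esub>"
    unfolding 0 by (rule alg_hom_zero[OF k_algebra_clifford_type k_algebra_linear_endomorphisms h])
  then have "v $ j = 0" if "j \<le> n" for j
    using hv[rule_format, OF that, of v] by (simp add: linear_endomorphisms_def)
  then show ?thesis using v by (intro eq_vecI) auto
qed

end

section \<open>Orthogonal bases and diagonal presentations\<close>

lemma (in k_algebra) smult_one_eq_zero:
  assumes "\<one> \<noteq> \<zero>" "c \<odot> \<one> = \<zero>"
  shows "c = 0"
proof (rule ccontr)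
  assume "c \<noteq> 0"
  then have "\<one> = inverse c \<odot> (c \<odot> \<one>)" by (simp flip: smult_assoc)
  with assms show False by simp
qed

text \<open>
  The polar form of \<open>q\<close> is twice the bilinear form of \<open>M\<close>, and \<open>2\<close> is invertible, so both have the
  same orthogonal pairs.
\<close>

lemma orthogonal_basis_iff:
  fixes b :: "nat \<Rightarrow> 'k::field vec" and M :: "'k mat"
  assumes two: "(2::'k) \<noteq> 0" and M: "M \<in> carrier_mat (n + 1) (n + 1)" "transpose_mat M = M"
    and b: "\<And>i. i < n + 1 \<Longrightarrow> b i \<in> carrier_vec (n + 1)"
  shows "orthogonal_basis (module_vec TYPE('k) (n + 1)) (quad_form M) n b \<longleftrightarrow>
    det (cols_mat (n + 1) b) \<noteq> 0 \<and> (\<forall>i<n+1. \<forall>j<n+1. i \<noteq> j \<longrightarrow> b i \<bullet> (M *\<^sub>v b j) = 0)"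
proof -
  have set: "{0..n} = {..<n + 1}" by auto
  have "polar_form (module_vec TYPE('k) (n + 1)) (quad_form M) (b i) (b j) = 0 \<longleftrightarrow> b i \<bullet> (M *\<^sub>v b j) = 0"
    if "i < n + 1" "j < n + 1" for i j
    using polar_quad_form[OF M b[OF that(1)] b[OF that(2)]] two by simp
  then show ?thesis
    using basis_iff_det[of "n + 1" b, OF b]
    unfolding orthogonal_basis_def set by (metis lessThan_iff)
qed

lemma orthogonal_basis_carrier:
  fixes b :: "nat \<Rightarrow> 'k::field vec"
  assumes "orthogonal_basis (module_vec TYPE('k) m) q n b" "i < n + 1"
  shows "b i \<in> carrier_vec m"
proof -
  interpret V: vec_space "TYPE('k)" m .
  have "b ` {0..n} \<subseteq> carrier_vec m"
    using assms(1) by (simp add: orthogonal_basis_def V.basis_def)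
  then show ?thesis using assms(2) by auto
qed

lemma cols_mat_mult_unit_vec:
  fixes b :: "nat \<Rightarrow> 'k::field vec"
  assumes "i < m" "b i \<in> carrier_vec m"
  shows "cols_mat m b *\<^sub>v unit_vec m i = b i"
  using assms by (intro eq_vecI) (auto simp: cols_mat_def)

context clifford_type
begin

text \<open>
  The entries of \<open>P\<^sup>T M P\<close> are the values of the bilinear form on pairs of basis vectors.
\<close>

lemma quad_form_diagonal:
  assumes b: "\<And>i. i < n + 1 \<Longrightarrow> b i \<in> carrier_vec (n + 1)"
    and orth: "\<And>i j. i < n + 1 \<Longrightarrow> j < n + 1 \<Longrightarrow> i \<noteq> j \<Longrightarrow> b i \<bullet> (M *\<^sub>v b j) = 0"
    and d: "\<And>i. i < n + 1 \<Longrightarrow> d i = quad_form M (b i)" and v: "v \<in> carrier_vec (n + 1)"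
  shows "quad_form M (cols_mat (n + 1) b *\<^sub>v v) = quad_form (cl_matrix n (d 0) d (\<lambda>_. 0) (\<lambda>_ _. 0)) v"
proof -
  let ?P = "cols_mat (n + 1) b" and ?N = "cl_matrix n (d 0) d (\<lambda>_. 0) (\<lambda>_ _. 0)"
  note M = cl_matrix_carrier[of n \<alpha> \<beta> \<gamma> lam]
  have P: "?P \<in> carrier_mat (n + 1) (n + 1)" by simp
  have PT: "transpose_mat ?P \<in> carrier_mat (n + 1) (n + 1)"
    by (rule carrier_matI) (simp_all add: cols_mat_def)
  have MP: "M * ?P \<in> carrier_mat (n + 1) (n + 1)" using M P by (rule mult_carrier_mat)
  have col: "col ?P i = b i" if "i < n + 1" for i
    using that b[OF that] by (intro eq_vecI) (auto simp: cols_mat_def)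
  have "transpose_mat ?P * (M * ?P) = ?N"
  proof (rule eq_matI)
    fix i j assume "i < dim_row ?N" "j < dim_col ?N"
    then have i: "i < n + 1" and j: "j < n + 1" by (simp_all add: cl_matrix_def)
    have "(transpose_mat ?P * (M * ?P)) $$ (i, j) = row (transpose_mat ?P) i \<bullet> col (M * ?P) j"
      using i j P MP by (intro index_mult_mat(1)) auto
    also have "col (M * ?P) j = M *\<^sub>v b j" using col_mult2[OF M P j] col[OF j] by simp
    also have "row (transpose_mat ?P) i = b i" using i col[OF i] carrier_matD(2)[OF P] by simp
    also have "b i \<bullet> (M *\<^sub>v b j) = ?N $$ (i, j)"
      using orth[OF i j] d[OF i] i j by (auto simp: cl_matrix_def quad_form_def)
    finally show "(transpose_mat ?P * (M * ?P)) $$ (i, j) = ?N $$ (i, j)" .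
  qed (simp_all add: cl_matrix_def cols_mat_def)
  moreover have "quad_form M (?P *\<^sub>v v) = v \<bullet> ((transpose_mat ?P * (M * ?P)) *\<^sub>v v)"
  proof -
    have Pv: "?P *\<^sub>v v \<in> carrier_vec (n + 1)" and MPv: "(M * ?P) *\<^sub>v v \<in> carrier_vec (n + 1)"
      using mult_mat_vec_carrier[OF P v] mult_mat_vec_carrier[OF MP v] .
    have "quad_form M (?P *\<^sub>v v) = (?P *\<^sub>v v) \<bullet> ((M * ?P) *\<^sub>v v)"
      using assoc_mult_mat_vec[OF M P v] by (simp add: quad_form_def)
    also have "\<dots> = ((M * ?P) *\<^sub>v v) \<bullet> (?P *\<^sub>v v)" by (rule comm_scalar_prod[OF Pv MPv])
    also have "\<dots> = (transpose_mat ?P *\<^sub>v ((M * ?P) *\<^sub>v v)) \<bullet> v"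
      by (rule transpose_vec_mult_scalar[OF P v MPv, symmetric])
    also have "\<dots> = ((transpose_mat ?P * (M * ?P)) *\<^sub>v v) \<bullet> v"
      using assoc_mult_mat_vec[OF PT MP v] by simp
    also have "\<dots> = v \<bullet> ((transpose_mat ?P * (M * ?P)) *\<^sub>v v)"
    proof (rule comm_scalar_prod[OF _ v])
      show "(transpose_mat ?P * (M * ?P)) *\<^sub>v v \<in> carrier_vec (n + 1)"
        by (rule mult_mat_vec_carrier[OF mult_carrier_mat[OF PT MP] v])
    qed
    finally show ?thesis .
  qed
  ultimately show ?thesis by (simp add: quad_form_def)
qed

text \<open>
  The matrix with the columns \<open>b\<^sub>i\<close> is an isometry from the diagonal form to the given one, and it sends
  the unit vector \<open>e\<^sub>i\<close> to \<open>b\<^sub>i\<close>.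
\<close>

lemma diagonal_presentation_of_orthogonal_basis:
  assumes orth: "orthogonal_basis V (quad_form M) n b"
  shows "diagonal_presentation n \<alpha> \<beta> \<gamma> lam b (\<lambda>i. quad_form M (b i))"
proof -
  let ?d = "\<lambda>i. quad_form M (b i)" and ?P = "cols_mat (n + 1) b"
  interpret D: diagonal_clifford_type n ?d by unfold_locales (rule two)
  have b: "b i \<in> carrier_vec (n + 1)" if "i < n + 1" for i
    by (rule orthogonal_basis_carrier[OF orth that])
  have det: "det ?P \<noteq> 0" and b_orth: "\<And>i j. i < n + 1 \<Longrightarrow> j < n + 1 \<Longrightarrow> i \<noteq> j \<Longrightarrow> b i \<bullet> (M *\<^sub>v b j) = 0"
    using orth orthogonal_basis_iff[OF two cl_matrix_carrier cl_matrix_symmetric, of n b] b by auto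
  obtain C where C: "C \<in> carrier_mat (n + 1) (n + 1)" and CP: "C * ?P = 1\<^sub>m (n + 1)" and PC: "?P * C = 1\<^sub>m (n + 1)"
    using det_non_zero_imp_unit[OF cols_mat_carrier det, of "()"]
    unfolding Units_def ring_mat_def by auto
  obtain \<phi> where \<phi>: "\<phi> \<in> alg_iso D.A A" and \<phi>v: "\<forall>v\<in>carrier_vec (n + 1). \<phi> (D.\<iota> v) = \<iota> (?P *\<^sub>v v)"
    using change_of_basis[OF two cols_mat_carrier C PC CP,
        of \<alpha> \<beta> \<gamma> lam "?d 0" ?d "\<lambda>_. 0" "\<lambda>_ _. 0"]
      quad_form_diagonal[of b ?d, OF b b_orth] by (auto simp: cl_form_eq)
  have \<phi>a: "\<phi> (D.a i) = \<iota> (b i)" if "i \<le> n" for i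
  proof -
    have i: "i < n + 1" using that by simp
    show ?thesis
      using \<phi>v[rule_format, OF unit_vec_carrier, of i]
      unfolding D.clifford_type_lin_unit[OF that] cols_mat_mult_unit_vec[of i "n + 1" b, OF i b[OF i]] .
  qed
  show ?thesis
    unfolding diagonal_presentation_def Let_def
  proof (intro bexI[OF _ \<phi>] conjI ballI)
    show "\<phi> (clifford_type_gen n (?d 0) ?d (\<lambda>_. 0) (\<lambda>_ _. 0) Gen_G) = \<iota> (b 0)"
      using \<phi>a[of 0] by (simp add: nth_gen_def)
    fix i assume "i \<in> {1..n}"
    then show "\<phi> (clifford_type_gen n (?d 0) ?d (\<lambda>_. 0) (\<lambda>_ _. 0) (Gen_X i)) = \<iota> (b i)"
      using \<phi>a[of i] by (simp add: nth_gen_def)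
  qed
qed

lemma exists_orthogonal_basis: "\<exists>b. orthogonal_basis V (quad_form M) n b"
proof -
  obtain b where b: "\<forall>i<n+1. b i \<in> carrier_vec (n + 1)" and "det (cols_mat (n + 1) b) \<noteq> 0"
    "\<forall>i<n+1. \<forall>j<n+1. i \<noteq> j \<longrightarrow> b i \<bullet> (M *\<^sub>v b j) = 0"
    using exists_orthogonal_family[OF two cl_matrix_carrier cl_matrix_symmetric, of n] by blast
  then have "orthogonal_basis V (quad_form M) n b"
    by (subst orthogonal_basis_iff[OF two cl_matrix_carrier cl_matrix_symmetric]) auto
  then show ?thesis by blast
qed

text \<open>
  Known for diagonal algebras from their representation, and every Clifford-type algebra is
  isomorphic to a diagonal one.
\<close>

lemma one_neq_zero: "\<one>\<^bsub>A\<^esub> \<noteq> \<zero>\<^bsub>A\<^esub>"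
proof
  assume A: "\<one>\<^bsub>A\<^esub> = \<zero>\<^bsub>A\<^esub>"
  obtain b where "orthogonal_basis V (quad_form M) n b" using exists_orthogonal_basis by blast
  then have pres: "diagonal_presentation n \<alpha> \<beta> \<gamma> lam b (\<lambda>i. quad_form M (b i))"
    by (rule diagonal_presentation_of_orthogonal_basis)
  interpret D: diagonal_clifford_type n "\<lambda>i. quad_form M (b i)" by unfold_locales (rule two)
  interpret DA: k_algebra D.A by (rule D.k_algebra_clifford_type)
  from pres obtain \<phi> where \<phi>: "\<phi> \<in> alg_iso D.A A" by (auto simp: diagonal_presentation_def Let_def)
  have "\<phi> \<one>\<^bsub>D.A\<^esub> = \<phi> \<zero>\<^bsub>D.A\<^esub>"
    using A alg_hom_one[OF alg_iso_hom[OF \<phi>]]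
      alg_hom_zero[OF D.k_algebra_clifford_type k_algebra_clifford_type alg_iso_hom[OF \<phi>]] by simp
  then have "\<one>\<^bsub>D.A\<^esub> = \<zero>\<^bsub>D.A\<^esub>"
    using alg_iso_inj[OF \<phi>] by (simp add: inj_on_eq_iff)
  with D.diagonal_one_neq_zero show False by contradiction
qed

text \<open>
  The isomorphism intertwines the canonical map of the diagonal algebra with the linear map of the
  matrix of \<open>b\<close>.  The former is injective, so the matrix is.  The off-diagonal relations of the
  diagonal algebra give \<open>2 B(b\<^sub>i, b\<^sub>j) 1 = 0\<close>, and \<open>1 \<noteq> 0\<close> in the algebra.
\<close>

lemma orthogonal_basis_of_diagonal_presentation:
  assumes b: "\<And>i. i \<le> n \<Longrightarrow> b i \<in> carrier_vec (n + 1)"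
    and pres: "diagonal_presentation n \<alpha> \<beta> \<gamma> lam b d"
  shows "orthogonal_basis V (quad_form M) n b"
proof -
  interpret D: diagonal_clifford_type n d by unfold_locales (rule two)
  interpret A: k_algebra A by (rule k_algebra_clifford_type)
  interpret DA: k_algebra D.A by (rule D.k_algebra_clifford_type)
  from pres obtain \<phi> where \<phi>: "\<phi> \<in> alg_iso D.A A" and \<phi>0: "\<phi> (D.a 0) = \<iota> (b 0)"
    and \<phi>X: "\<forall>i\<in>{1..n}. \<phi> (D.a i) = \<iota> (b i)"
    by (auto simp: diagonal_presentation_def Let_def nth_gen_def)
  have \<phi>a: "\<phi> (D.a i) = \<iota> (b i)" if "i \<le> n" for i
    using that \<phi>0 \<phi>X by (cases "i = 0") auto
  note hom = alg_iso_hom[OF \<phi>]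
  \<comment> \<open>A Clifford map for the diagonal form, hence linear; its values on unit vectors are known.\<close>
  have \<phi>\<iota>: "clifford_map V (quad_form D.M) A (\<lambda>v. \<phi> (D.\<iota> v))"
    using clifford_mapD[OF D.clifford_map_clifford_type_lin]
    unfolding clifford_map_def
    by (auto simp: alg_hom_closed[OF hom] alg_hom_add[OF hom] alg_hom_smult[OF hom] alg_hom_one[OF hom]
        simp flip: alg_hom_mult[OF hom])
  let ?P = "cols_mat (n + 1) b"
  have gens: "\<phi> (D.\<iota> (unit_vec (n + 1) i)) = \<iota> (?P *\<^sub>v unit_vec (n + 1) i)" if "i \<le> n" for i
    unfolding D.clifford_type_lin_unit[OF that] \<phi>a[OF that]
    by (rule arg_cong[OF cols_mat_mult_unit_vec[of i "n + 1" b, symmetric]]) (use that b in auto)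
  have comb: "\<phi> (D.\<iota> v) = \<iota> (?P *\<^sub>v v)" if v: "v \<in> carrier_vec (n + 1)" for v
  proof -
    have \<iota>P: "clifford_map V (\<lambda>v. quad_form M (?P *\<^sub>v v)) A (\<lambda>v. \<iota> (?P *\<^sub>v v))"
      by (rule clifford_map_comp_mat[OF clifford_map_clifford_type_lin cols_mat_carrier refl])
    have "\<phi> (D.\<iota> v) = A.lin_comb n (\<lambda>i. \<phi> (D.\<iota> (unit_vec (n + 1) i))) v"
      by (rule A.clifford_map_eq_lin_comb[OF \<phi>\<iota> v])
    also have "\<dots> = A.lin_comb n (\<lambda>i. \<iota> (?P *\<^sub>v unit_vec (n + 1) i)) v"
      unfolding A.lin_comb_def
    proof (rule A.finsum_cong')
      fix i assume "i \<in> {0..n}"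
      then show "v $ i \<odot>\<^bsub>A\<^esub> \<phi> (D.\<iota> (unit_vec (n + 1) i)) = v $ i \<odot>\<^bsub>A\<^esub> \<iota> (?P *\<^sub>v unit_vec (n + 1) i)"
        using gens[of i] by simp
    qed (use clifford_mapD(1)[OF \<iota>P] in \<open>auto simp: module_vec_simps\<close>)
    also have "\<dots> = \<iota> (?P *\<^sub>v v)"
      by (rule A.clifford_map_eq_lin_comb[OF \<iota>P v, symmetric])
    finally show ?thesis .
  qed
  have "det ?P \<noteq> 0"
    unfolding det_nonzero_iff_inj[OF cols_mat_carrier]
  proof (intro ballI impI)
    fix v :: "'k vec" assume v: "v \<in> carrier_vec (n + 1)" and 0: "?P *\<^sub>v v = 0\<^sub>v (n + 1)"
    have "0 \<cdot>\<^sub>v 0\<^sub>v (n + 1) = (0\<^sub>v (n + 1) :: 'k vec)" by auto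
    then have "\<iota> (0\<^sub>v (n + 1)) = \<zero>\<^bsub>A\<^esub>"
      using clifford_mapD(3)[OF clifford_map_clifford_type_lin, of "0\<^sub>v (n + 1)" 0]
        clifford_mapD(1)[OF clifford_map_clifford_type_lin, of "0\<^sub>v (n + 1)"]
      by (simp add: module_vec_simps)
    then have "\<phi> (D.\<iota> v) = \<phi> \<zero>\<^bsub>D.A\<^esub>"
      using comb[OF v] 0 alg_hom_zero[OF D.k_algebra_clifford_type k_algebra_clifford_type hom] by simp
    moreover have "D.\<iota> v \<in> carrier D.A"
      using clifford_mapD(1)[OF D.clifford_map_clifford_type_lin] v by (simp add: module_vec_simps)
    ultimately have "D.\<iota> v = \<zero>\<^bsub>D.A\<^esub>"
      using alg_iso_inj[OF \<phi>] by (simp add: inj_on_eq_iff)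
    then show "v = 0\<^sub>v (n + 1)" by (rule D.clifford_type_lin_inj[OF v])
  qed
  moreover have "b i \<bullet> (M *\<^sub>v b j) = 0" if i: "i < n + 1" and j: "j < n + 1" and ij: "i \<noteq> j" for i j
  proof -
    have eq: "\<phi> (D.\<iota> (unit_vec (n + 1) k)) = \<iota> (b k)" if "k < n + 1" for k
      using gens[of k] cols_mat_mult_unit_vec[of k "n + 1" b] b[of k] that by simp
    have "\<iota> (b i) \<otimes>\<^bsub>A\<^esub> \<iota> (b j) \<oplus>\<^bsub>A\<^esub> \<iota> (b j) \<otimes>\<^bsub>A\<^esub> \<iota> (b i) = (2 * D.M $$ (i, j)) \<odot>\<^bsub>A\<^esub> \<one>\<^bsub>A\<^esub>"
      using A.clifford_family_cliff_map[OF \<phi>\<iota> cl_matrix_carrier cl_matrix_symmetric] i j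
        eq[OF i, symmetric] eq[OF j, symmetric]
      by (simp add: clifford_family_def)
    also have "D.M $$ (i, j) = 0" using i j ij by (simp add: cl_matrix_def)
    finally have "(2 * (b i \<bullet> (M *\<^sub>v b j))) \<odot>\<^bsub>A\<^esub> \<one>\<^bsub>A\<^esub> = \<zero>\<^bsub>A\<^esub>"
      using A.clifford_map_polar[OF clifford_map_clifford_type_lin, of "b i" "b j"]
        polar_quad_form[OF cl_matrix_carrier cl_matrix_symmetric, of "b i" n "b j"] b[of i] b[of j] i j
      by (simp add: module_vec_simps)
    then have "2 * (b i \<bullet> (M *\<^sub>v b j)) = 0" by (rule A.smult_one_eq_zero[OF one_neq_zero])
    then show ?thesis using two by simp
  qed
  ultimately show ?thesis
    using b by (subst orthogonal_basis_iff[OF two cl_matrix_carrier cl_matrix_symmetric]) auto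
qed

end

theorem theorem3p2:
  fixes n :: nat
    and \<alpha> :: "'k::field"
    and \<beta> \<gamma> :: "nat \<Rightarrow> 'k"
    and lam :: "nat \<Rightarrow> nat \<Rightarrow> 'k"
  assumes "CHAR('k) \<noteq> 2"
  shows "let V = module_vec TYPE('k) (n + 1);
             q = cl_form n \<alpha> \<beta> \<gamma> lam;
             A = clifford_type_alg n \<alpha> \<beta> \<gamma> lam
         in alg_iso (clifford_alg V q) A \<noteq> {} \<and>
            (\<exists>b. orthogonal_basis V q n b) \<and>
            (\<forall>b. orthogonal_basis V q n b \<longrightarrow>
                  diagonal_presentation n \<alpha> \<beta> \<gamma> lam b (\<lambda>i. q (b i))) \<and>
            (\<forall>b d. (\<forall>i\<in>{0..n}. b i \<in> carrier V) \<longrightarrow>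
                  diagonal_presentation n \<alpha> \<beta> \<gamma> lam b d \<longrightarrow> orthogonal_basis V q n b)"
proof -
  have "(2::'k) \<noteq> 0"
  proof
    assume "(2::'k) = 0"
    then have "CHAR('k) dvd 2" using of_nat_eq_0_iff_char_dvd[of 2, where ?'a = 'k] by simp
    then have "CHAR('k) = 1 \<or> CHAR('k) = 2" using two_is_prime_nat prime_nat_iff by blast
    with assms show False by simp
  qed
  then interpret clifford_type n \<alpha> \<beta> \<gamma> lam by unfold_locales
  show ?thesis
    unfolding Let_def cl_form_eq
    using clifford_alg_iso exists_orthogonal_basis diagonal_presentation_of_orthogonal_basis
      orthogonal_basis_of_diagonal_presentation by (auto simp: module_vec_simps)
qed

end
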